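(* Let $(M,\omega,J_0)$ be a compact K\"ahler manifold with real analytic $\omega$ and $J_0$, let $h$ be a real valued real analytic function on $M$, and let $\tau\in\mathbb{C}$. Let $\iota:M\hookrightarrow M_{\mathbb{C}}$ be the complexification of $M$, let $\eta_t$ be the time-$t$ flow on (a neighbourhood of $M$ in) $M_{\mathbb{C}}$ of $-X^{\frac12(\omega_{\mathbb{C}}+\bar\omega_{\mathbb{C}})}_{{\rm Re}\,\tilde h_{\mathbb{C}}}$ with $\tilde h=\tau h$, and let $\pi_t$ be the projection to $M$ along the leaves of the foliation $\mathcal{F}_t=(\eta_t)_*\mathcal{F}_0$. Let $\varphi_{t\tau}:(M,J_{t\tau})\to(M,J_0)$ be the biholomorphism acting on local $J_0$-holomorphic coordinates as $e^{t\tau X_h}$. Then, for $t\in\mathbb{R}$ with $|t|$ small enough, $$\varphi_{t\tau}^{-1}=\pi_t\circ\eta_t\circ\iota ,$$ equivalently, $\varphi_{t\tau}\circ\pi_t\circ\eta_t\circ\iota={\rm id}_M$.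
   Context: Conventions: $\iota_{X_f}\omega=df$, and similarly for other symplectic forms (indicated as superscripts). For a real analytic vector field $X$, $e^{\sigma X}\cdot f=\sum_{k\ge0}\frac{\sigma^k}{k!}X^k(f)$ for $\sigma\in\mathbb{C}$ (Lie series, where convergent). For $|\sigma|$ small, there are a complex structure $J_\sigma$ on $M$ and a unique biholomorphism $\varphi_\sigma:(M,J_\sigma)\to(M,J_0)$ which acts on local $J_0$-holomorphic coordinates as $e^{\sigma X_h}$, i.e. around every point there are $J_0$-holomorphic coordinates $z^i$ on an open $U$ and a smaller neighbourhood $V\subset U$ with $\varphi_\sigma(V)\subset U$ and $z^i\circ\varphi_\sigma=e^{\sigma X_h}\cdot z^i$ on $V$; moreover $(M,\omega,J_\sigma)$ is K\"ahler. Complexification: $(M_{\mathbb{C}},\omega_{\mathbb{C}})$ is a holomorphic symplectic manifold containing $M$ (via $\iota$) as the fixed point set of an anti-holomorphic involution. If $z=(z^1,\dots,z^n)$ are local $J_0$-holomorphic coordinates on $U\subset M$, then $U_{\mathbb{C}}\subset M_{\mathbb{C}}$ has holomorphic coordinates $(z_{\mathbb{C}},w_{\mathbb{C}})$ which are the analytic continuations of $(z,\bar z)$, so that $U=\{w_{\mathbb{C}}=\bar z_{\mathbb{C}}\}$; if $\omega=\sum i\,g_{j\bar k}(z,\bar z)\,dz^j\wedge d\bar z^k$ then $\omega_{\mathbb{C}}=\sum i\,g^{\mathbb{C}}_{jk}(z_{\mathbb{C}},w_{\mathbb{C}})\,dz^j_{\mathbb{C}}\wedge dw^k_{\mathbb{C}}$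 with $g^{\mathbb{C}}_{jk}$ the analytic continuation of $g_{j\bar k}$. The holomorphic projection $\pi_0:M_{\mathbb{C}}\to M$ is $\pi_0(z_{\mathbb{C}},w_{\mathbb{C}})=z_{\mathbb{C}}$, with $\pi_0\circ\iota={\rm id}_M$, and $\mathcal{F}_0$ is the foliation of $M_{\mathbb{C}}$ by the fibres of $\pi_0$. $\tilde h_{\mathbb{C}}$ is the analytic continuation of $\tilde h=\tau h$ (and $h_{\mathbb{C}}$ that of $h$), and the Hamiltonian vector field of ${\rm Re}\,\tilde h_{\mathbb{C}}$ with respect to the real symplectic form $\frac12(\omega_{\mathbb{C}}+\bar\omega_{\mathbb{C}})$ is $\tau X^{\omega_{\mathbb{C}}}_{h_{\mathbb{C}}}+\bar\tau X^{\bar\omega_{\mathbb{C}}}_{\bar h_{\mathbb{C}}}$. For $|t|$ small, $\pi_t$ sends a point of $M_{\mathbb{C}}$ near $M$ to the point at which the leaf of $\mathcal{F}_t$ through it (near $M$) intersects $M$. ($M_{\mathbb{C}}$ may be shrunk to a smaller neighbourhood of $M$ where necessary.) *)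

theory Defs
  imports "HOL-Analysis.Analysis"
begin

text \<open>Power series in the coordinates \<open>u \<bullet> b\<close> (\<open>b \<in> Basis\<close>); a multi-index is a function
  \<open>\<alpha>\<close> that vanishes off \<open>Basis\<close>, and the sum over all multi-indices is unconditional.\<close>

definition real_analytic_on ::
    "'e::euclidean_space set \<Rightarrow> ('e \<Rightarrow> 'f::real_normed_vector) \<Rightarrow> bool" where
  "real_analytic_on S f \<longleftrightarrow>
    (\<forall>x\<in>S. \<exists>a. \<exists>r>0. \<forall>u. norm u < r \<longrightarrow>
      ((\<lambda>\<alpha>. (\<Prod>b\<in>Basis. (u \<bullet> b) ^ \<alpha> b) *\<^sub>R a \<alpha>) has_sum f (x + u))
        {\<alpha>::'e \<Rightarrow> nat. \<forall>b. b \<notin> Basis \<longrightarrow> \<alpha> b = 0})"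

text \<open>\<open>C\<^sup>k\<close> on an open set, by recursion over the partial derivatives.\<close>

primrec Ck_on ::
    "nat \<Rightarrow> 'e::euclidean_space set \<Rightarrow> ('e \<Rightarrow> 'f::real_normed_vector) \<Rightarrow> bool" where
  "Ck_on 0 S f \<longleftrightarrow> continuous_on S f"
| "Ck_on (Suc k) S f \<longleftrightarrow>
    (\<forall>x\<in>S. f differentiable (at x)) \<and>
    (\<forall>b\<in>Basis. Ck_on k S (\<lambda>x. frechet_derivative f (at x) b))"

definition smooth_on ::
    "'e::euclidean_space set \<Rightarrow> ('e \<Rightarrow> 'f::real_normed_vector) \<Rightarrow> bool" where
  "smooth_on S f \<longleftrightarrow> (\<forall>k. Ck_on k S f)"

definition holo_on :: "(complex^'n) set \<Rightarrow> (complex^'n \<Rightarrow> complex) \<Rightarrow> bool" where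
  "holo_on S f \<longleftrightarrow>
    (\<forall>x\<in>S. \<exists>D. (f has_derivative D) (at x) \<and> (\<forall>a v. D (a *s v) = a * D v))"

definition holo_map_on :: "(complex^'n) set \<Rightarrow> (complex^'n \<Rightarrow> complex^'k) \<Rightarrow> bool" where
  "holo_map_on S f \<longleftrightarrow> (\<forall>i. holo_on S (\<lambda>x. f x $ i))"

definition cnj_vec :: "complex^'n \<Rightarrow> complex^'n" where
  "cnj_vec z = (\<chi> i. cnj (z $ i))"

text \<open>A chart is a pair of a domain and a coordinate map; the coordinate map is a total function
  whose values off the domain are irrelevant.  For \<open>'e = complex^'n\<close> a chart serves both as a
  real chart (with values in \<open>\<real>\<^sup>2\<^sup>n\<close>) and as a complex one, depending on the structure it
  belongs to.\<close>

type_synonym ('m, 'e) chart = "'m set \<times> ('m \<Rightarrow> 'e)"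

abbreviation chart_dom :: "('m, 'e) chart \<Rightarrow> 'm set" where "chart_dom \<equiv> fst"
abbreviation coord :: "('m, 'e) chart \<Rightarrow> 'm \<Rightarrow> 'e" where "coord \<equiv> snd"
abbreviation chart_img :: "('m, 'e) chart \<Rightarrow> 'e set" where
  "chart_img c \<equiv> coord c ` chart_dom c"

definition param :: "('m, 'e) chart \<Rightarrow> 'e \<Rightarrow> 'm" where
  "param c = inv_into (chart_dom c) (coord c)"

definition is_chart :: "('m::topological_space, 'e::euclidean_space) chart \<Rightarrow> bool" where
  "is_chart c \<longleftrightarrow> open (chart_dom c) \<and> open (chart_img c) \<and>
     homeomorphism (chart_dom c) (chart_img c) (coord c) (param c)"

definition transition :: "('m, 'e) chart \<Rightarrow> ('m, 'e) chart \<Rightarrow> 'e \<Rightarrow> 'e" where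
  "transition c c' = coord c' \<circ> param c"

text \<open>\<open>K S f\<close> is the regularity demanded of \<open>f\<close> on the open set \<open>S\<close>.\<close>

definition compatible ::
    "('e set \<Rightarrow> ('e \<Rightarrow> 'e) \<Rightarrow> bool) \<Rightarrow> ('m, 'e) chart \<Rightarrow> ('m, 'e) chart \<Rightarrow> bool" where
  "compatible K c c' \<longleftrightarrow>
     K (coord c ` (chart_dom c \<inter> chart_dom c')) (transition c c') \<and>
     K (coord c' ` (chart_dom c \<inter> chart_dom c')) (transition c' c)"

definition max_atlas ::
    "('e set \<Rightarrow> ('e \<Rightarrow> 'e) \<Rightarrow> bool) \<Rightarrow> ('m::topological_space, 'e::euclidean_space) chart set
      \<Rightarrow> ('m, 'e) chart set" where
  "max_atlas K A = {c. is_chart c \<and> (\<forall>c'\<in>A. compatible K c c')}"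

definition mfd_structure ::
    "('e set \<Rightarrow> ('e \<Rightarrow> 'e) \<Rightarrow> bool) \<Rightarrow> ('m::topological_space, 'e::euclidean_space) chart set
      \<Rightarrow> bool" where
  "mfd_structure K A \<longleftrightarrow> (\<Union>c\<in>A. chart_dom c) = UNIV \<and> A = max_atlas K A"

abbreviation real_analytic_structure ::
    "('m::topological_space, 'e::euclidean_space) chart set \<Rightarrow> bool" where
  "real_analytic_structure \<equiv> mfd_structure real_analytic_on"

abbreviation complex_structure ::
    "('m::topological_space, complex^'n) chart set \<Rightarrow> bool" where
  "complex_structure \<equiv> mfd_structure holo_map_on"

abbreviation smooth_charts ::
    "('m::topological_space, 'e::euclidean_space) chart set \<Rightarrow> ('m, 'e) chart set" where
  "smooth_charts \<equiv> max_atlas smooth_on"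

definition holo_between ::
    "('a::topological_space, complex^'n) chart set \<Rightarrow> ('b::topological_space, complex^'k) chart set
      \<Rightarrow> ('a \<Rightarrow> 'b) \<Rightarrow> bool" where
  "holo_between A B f \<longleftrightarrow> continuous_on UNIV f \<and>
     (\<forall>c\<in>A. \<forall>c'\<in>B. holo_map_on (coord c ` (chart_dom c \<inter> f -` chart_dom c'))
        (coord c' \<circ> f \<circ> param c))"

definition antiholo_between ::
    "('a::topological_space, complex^'n) chart set \<Rightarrow> ('b::topological_space, complex^'k) chart set
      \<Rightarrow> ('a \<Rightarrow> 'b) \<Rightarrow> bool" where
  "antiholo_between A B f \<longleftrightarrow> continuous_on UNIV f \<and>
     (\<forall>c\<in>A. \<forall>c'\<in>B. holo_map_on (coord c ` (chart_dom c \<inter> f -` chart_dom c'))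
        (cnj_vec \<circ> coord c' \<circ> f \<circ> param c))"

definition biholomorphism ::
    "('a::topological_space, complex^'n) chart set \<Rightarrow> ('b::topological_space, complex^'n) chart set
      \<Rightarrow> ('a \<Rightarrow> 'b) \<Rightarrow> bool" where
  "biholomorphism A B f \<longleftrightarrow> bij f \<and> holo_between A B f \<and> holo_between B A (inv f)"

definition regular_fun ::
    "('e set \<Rightarrow> ('e \<Rightarrow> 'f) \<Rightarrow> bool) \<Rightarrow> ('m, 'e) chart set \<Rightarrow> ('m \<Rightarrow> 'f) \<Rightarrow> bool" where
  "regular_fun K A f \<longleftrightarrow> (\<forall>c\<in>A. K (chart_img c) (f \<circ> param c))"

text \<open>A 2-form is given by its local representatives: \<open>\<omega> c p u v\<close> is the value at \<open>p\<close> on the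
  tangent vectors with components \<open>u\<close>, \<open>v\<close> in the chart \<open>c\<close>.  Likewise \<open>X c p\<close> is the
  component vector in the chart \<open>c\<close> of a (real) vector field.\<close>

type_synonym ('m, 'e, 'f) form2 = "('m, 'e) chart \<Rightarrow> 'm \<Rightarrow> 'e \<Rightarrow> 'e \<Rightarrow> 'f"
type_synonym ('m, 'e) vfield = "('m, 'e) chart \<Rightarrow> 'm \<Rightarrow> 'e"

definition regular_form ::
    "('e set \<Rightarrow> ('e \<Rightarrow> 'f) \<Rightarrow> bool) \<Rightarrow> ('m, 'e) chart set \<Rightarrow> ('m, 'e, 'f) form2 \<Rightarrow> bool" where
  "regular_form K A \<omega> \<longleftrightarrow>
     (\<forall>c\<in>A. \<forall>u v. K (chart_img c) (\<lambda>x. \<omega> c (param c x) u v))"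

definition two_form ::
    "('m, 'e::euclidean_space) chart set \<Rightarrow> ('m, 'e, 'f::real_normed_vector) form2 \<Rightarrow> bool" where
  "two_form A \<omega> \<longleftrightarrow>
     (\<forall>c\<in>A. \<forall>p\<in>chart_dom c. bilinear (\<omega> c p) \<and> (\<forall>u. \<omega> c p u u = 0)) \<and>
     (\<forall>c\<in>A. \<forall>c'\<in>A. \<forall>p\<in>chart_dom c \<inter> chart_dom c'. \<forall>u v.
        \<omega> c p u v =
        \<omega> c' p (frechet_derivative (transition c c') (at (coord c p)) u)
               (frechet_derivative (transition c c') (at (coord c p)) v))"

text \<open>\<open>d\<omega> = 0\<close>, evaluated on the constant vector fields \<open>u\<close>, \<open>v\<close>, \<open>w\<close> of a chart.\<close>

definition closed_form ::
    "('m, 'e::euclidean_space) chart set \<Rightarrow> ('m, 'e, 'f::real_normed_vector) form2 \<Rightarrow> bool" where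
  "closed_form A \<omega> \<longleftrightarrow>
     (\<forall>c\<in>A. \<forall>x\<in>chart_img c. \<forall>u v w.
        frechet_derivative (\<lambda>y. \<omega> c (param c y) v w) (at x) u +
        frechet_derivative (\<lambda>y. \<omega> c (param c y) w u) (at x) v +
        frechet_derivative (\<lambda>y. \<omega> c (param c y) u v) (at x) w = 0)"

definition kaehler ::
    "('m::topological_space, complex^'n) chart set \<Rightarrow> ('m, complex^'n) chart set
      \<Rightarrow> ('m, complex^'n, real) form2 \<Rightarrow> bool" where
  "kaehler S J \<omega> \<longleftrightarrow>
     complex_structure J \<and> J \<subseteq> S \<and>
     two_form S \<omega> \<and> regular_form smooth_on S \<omega> \<and> closed_form S \<omega> \<and>
     (\<forall>c\<in>J. \<forall>p\<in>chart_dom c.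
        (\<forall>u v. \<omega> c p (\<i> *s u) (\<i> *s v) = \<omega> c p u v) \<and>
        (\<forall>u. u \<noteq> 0 \<longrightarrow> \<omega> c p u (\<i> *s u) > 0))"

definition holomorphic_symplectic ::
    "('m, complex^'k) chart set \<Rightarrow> ('m, complex^'k, complex) form2 \<Rightarrow> bool" where
  "holomorphic_symplectic A \<omega> \<longleftrightarrow>
     two_form A \<omega> \<and> regular_form holo_on A \<omega> \<and> closed_form A \<omega> \<and>
     (\<forall>c\<in>A. \<forall>p\<in>chart_dom c.
        (\<forall>a u v. \<omega> c p (a *s u) v = a * \<omega> c p u v) \<and>
        (\<forall>u. (\<forall>v. \<omega> c p u v = 0) \<longrightarrow> u = 0))"

definition dfun ::
    "('m, 'e::euclidean_space) chart \<Rightarrow> ('m \<Rightarrow> 'f::real_normed_vector) \<Rightarrow> 'm \<Rightarrow> 'e \<Rightarrow> 'f" where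
  "dfun c f p = frechet_derivative (f \<circ> param c) (at (coord c p))"

text \<open>Hamiltonian vector field of \<open>f\<close> for a nondegenerate real form, with the sign convention
  that the contraction of \<open>\<omega>\<close> with it (in the first slot) is \<open>df\<close>.\<close>

definition ham_vf ::
    "('m, 'e::euclidean_space, real) form2 \<Rightarrow> ('m \<Rightarrow> real) \<Rightarrow> ('m, 'e) vfield" where
  "ham_vf \<omega> f c p = (THE u. \<forall>v. \<omega> c p u v = dfun c f p v)"

definition lie ::
    "('m, 'e::euclidean_space) vfield \<Rightarrow> ('m, 'e) chart \<Rightarrow> ('m \<Rightarrow> 'f::real_normed_vector)
      \<Rightarrow> 'm \<Rightarrow> 'f" where
  "lie X c f p = dfun c f p (X c p)"

definition integral_curve_on ::
    "('m::topological_space, 'e::euclidean_space) chart set \<Rightarrow> ('m, 'e) vfield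
      \<Rightarrow> real set \<Rightarrow> (real \<Rightarrow> 'm) \<Rightarrow> bool" where
  "integral_curve_on A X I \<gamma> \<longleftrightarrow> continuous_on I \<gamma> \<and>
     (\<forall>t\<in>I. \<forall>c\<in>A. \<gamma> t \<in> chart_dom c \<longrightarrow>
        ((\<lambda>s. coord c (\<gamma> s)) has_vector_derivative X c (\<gamma> t)) (at t))"

definition local_flow ::
    "('m::topological_space, 'e::euclidean_space) chart set \<Rightarrow> ('m, 'e) vfield
      \<Rightarrow> 'm set \<Rightarrow> real \<Rightarrow> (real \<Rightarrow> 'm \<Rightarrow> 'm) \<Rightarrow> bool" where
  "local_flow A X W \<epsilon> \<eta> \<longleftrightarrow> open W \<and> \<epsilon> > 0 \<and>
     (\<forall>y\<in>W. \<eta> 0 y = y \<and> integral_curve_on A X {-\<epsilon><..<\<epsilon>} (\<lambda>t. \<eta> t y))"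

text \<open>The coordinates \<open>c\<close> and the neighbourhood \<open>V\<close> do not depend on \<open>\<sigma>\<close>: if they did, the
  condition would not determine \<open>\<phi> \<sigma>\<close>, not even for small \<open>\<sigma>\<close>.  (If \<open>X z = 1\<close>, use
  \<open>exp(2 \<pi> i z / \<sigma>)\<close> as a coordinate; the identity then acts on it as \<open>exp(\<sigma> X)\<close>.)\<close>

definition acts_as_exp ::
    "('m::topological_space, complex^'n) chart set \<Rightarrow> ('m, complex^'n) vfield
      \<Rightarrow> real \<Rightarrow> (complex \<Rightarrow> 'm \<Rightarrow> 'm) \<Rightarrow> bool" where
  "acts_as_exp J X \<epsilon> \<phi> \<longleftrightarrow>
     (\<forall>p. \<exists>c\<in>J. \<exists>V. open V \<and> p \<in> V \<and> V \<subseteq> chart_dom c \<and>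
        (\<forall>\<sigma>. cmod \<sigma> < \<epsilon> \<longrightarrow> \<phi> \<sigma> ` V \<subseteq> chart_dom c \<and>
           (\<forall>q\<in>V. \<forall>i. (\<lambda>k. \<sigma> ^ k / fact k * (lie X c ^^ k) (\<lambda>m. coord c m $ i) q)
              sums (coord c (\<phi> \<sigma> q) $ i))))"

text \<open>Coordinates on the complexification are indexed by \<open>'n + 'n\<close>: the \<open>Inl\<close>-components are
  \<open>z\<^sub>C\<close> and the \<open>Inr\<close>-components are \<open>w\<^sub>C\<close>.\<close>

definition zC :: "complex^('n + 'n) \<Rightarrow> complex^'n" where
  "zC x = (\<chi> j. x $ Inl j)"

definition wC :: "complex^('n + 'n) \<Rightarrow> complex^'n" where
  "wC x = (\<chi> k. x $ Inr k)"

text \<open>\<open>C\<close> gives coordinates \<open>(z\<^sub>C, w\<^sub>C)\<close> continuing \<open>(z, cnj z)\<close> for the holomorphic chart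
  \<open>c\<close>, in which \<open>\<pi>\<^sub>0(z\<^sub>C, w\<^sub>C) = z\<^sub>C\<close>, and the coefficients \<open>gC\<close> of \<open>\<omega>\<^sub>C\<close> continue those of
  \<open>\<omega>\<close>.  The wedge products are written out:
  \<open>(dz\<^sup>j \<and> dw\<^sup>k)(u, v) = dz\<^sup>j(u) dw\<^sup>k(v) - dz\<^sup>j(v) dw\<^sup>k(u)\<close>.\<close>

definition complexified_chart ::
    "('m, complex^'n, real) form2 \<Rightarrow> ('c, complex^('n + 'n), complex) form2
      \<Rightarrow> ('m \<Rightarrow> 'c) \<Rightarrow> ('c \<Rightarrow> 'm) \<Rightarrow> ('m, complex^'n) chart \<Rightarrow> ('c, complex^('n + 'n)) chart
      \<Rightarrow> bool" where
  "complexified_chart \<omega> \<omega>C \<iota> \<pi>\<^sub>0 c C \<longleftrightarrow>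
     (\<forall>p\<in>chart_dom c. zC (coord C (\<iota> p)) = coord c p \<and>
                      wC (coord C (\<iota> p)) = cnj_vec (coord c p)) \<and>
     \<iota> ` chart_dom c = {q \<in> chart_dom C. wC (coord C q) = cnj_vec (zC (coord C q))} \<and>
     (\<forall>q\<in>chart_dom C. \<pi>\<^sub>0 q \<in> chart_dom c \<and> coord c (\<pi>\<^sub>0 q) = zC (coord C q)) \<and>
     (\<exists>g gC.
        (\<forall>p\<in>chart_dom c. \<forall>u v. complex_of_real (\<omega> c p u v) =
           (\<Sum>j\<in>UNIV. \<Sum>k\<in>UNIV. \<i> * g p j k * (u $ j * cnj (v $ k) - v $ j * cnj (u $ k)))) \<and>
        (\<forall>q\<in>chart_dom C. \<forall>u v. \<omega>C C q u v =
           (\<Sum>j\<in>UNIV. \<Sum>k\<in>UNIV. \<i> * gC q j k *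
              (zC u $ j * wC v $ k - zC v $ j * wC u $ k))) \<and>
        (\<forall>j k. holo_on (chart_img C) (\<lambda>x. gC (param C x) j k)) \<and>
        (\<forall>p\<in>chart_dom c. \<forall>j k. gC (\<iota> p) j k = g p j k))"

definition complexification ::
    "('m::topological_space, complex^'n) chart set \<Rightarrow> ('m, complex^'n, real) form2
      \<Rightarrow> ('c::topological_space, complex^('n + 'n)) chart set
      \<Rightarrow> ('c, complex^('n + 'n), complex) form2 \<Rightarrow> ('m \<Rightarrow> 'c) \<Rightarrow> ('c \<Rightarrow> 'm) \<Rightarrow> bool" where
  "complexification J \<omega> JC \<omega>C \<iota> \<pi>\<^sub>0 \<longleftrightarrow>
     complex_structure JC \<and> holomorphic_symplectic JC \<omega>C \<and> inj \<iota> \<and>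
     (\<exists>\<kappa>. antiholo_between JC JC \<kappa> \<and> \<kappa> \<circ> \<kappa> = id \<and> range \<iota> = {q. \<kappa> q = q}) \<and>
     holo_between JC J \<pi>\<^sub>0 \<and> \<pi>\<^sub>0 \<circ> \<iota> = id \<and>
     (\<forall>c\<in>J. \<exists>C\<in>JC. complexified_chart \<omega> \<omega>C \<iota> \<pi>\<^sub>0 c C)"

definition analytic_continuation ::
    "('c, complex^'k) chart set \<Rightarrow> ('m \<Rightarrow> 'c) \<Rightarrow> ('m \<Rightarrow> complex) \<Rightarrow> ('c \<Rightarrow> complex) \<Rightarrow> bool" where
  "analytic_continuation JC \<iota> f fC \<longleftrightarrow> regular_fun holo_on JC fC \<and> fC \<circ> \<iota> = f"

text \<open>The real form \<open>(\<omega>\<^sub>C + cnj \<omega>\<^sub>C) / 2\<close>.\<close>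

definition re_form :: "('c, 'e, complex) form2 \<Rightarrow> ('c, 'e, real) form2" where
  "re_form \<omega>C c q u v = Re (\<omega>C c q u v)"

text \<open>A foliation is represented by its set of leaves.  The set \<open>W\<close> is the neighbourhood of \<open>M\<close>
  on which the flow lives, so that leaves are taken near \<open>M\<close>.\<close>

definition fibre_foliation :: "'c set \<Rightarrow> ('c \<Rightarrow> 'm) \<Rightarrow> 'c set set" where
  "fibre_foliation W \<pi>\<^sub>0 = range (\<lambda>a. W \<inter> \<pi>\<^sub>0 -` {a})"

definition push_foliation :: "('c \<Rightarrow> 'c) \<Rightarrow> 'c set set \<Rightarrow> 'c set set" where
  "push_foliation f F = (\<lambda>L. f ` L) ` F"

definition leaf_projection :: "('m \<Rightarrow> 'c) \<Rightarrow> 'c set set \<Rightarrow> 'c \<Rightarrow> 'm" where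
  "leaf_projection \<iota> F x = (THE p. \<exists>L\<in>F. x \<in> L \<and> \<iota> p \<in> L)"

end

theory Submission
  imports Defs "HOL-Complex_Analysis.Cauchy_Integral_Formula"
begin

text \<open>
  The Hamiltonian vector field of \<open>Re th\<^sub>C\<close> for the real form \<open>Re \<omega>\<^sub>C\<close> is the holomorphic Hamiltonian
  vector field \<open>Y\<close> of \<open>th\<^sub>C\<close> with respect to \<open>\<omega>\<^sub>C\<close>, regarded as a real vector field, because a
  complex linear functional is determined by its real part (\<open>ham_coords_cramer\<close>).  So
  \<open>s \<mapsto> \<eta> (- s) (\<iota> p)\<close> is an integral curve of \<open>Y\<close>.  Since \<open>\<omega>\<^sub>C\<close> restricts to \<open>\<omega>\<close> and the tangent
  spaces of \<open>M\<close> span those of its complexification over the complex numbers, \<open>Y = \<tau> X\<^sub>h\<close> along \<open>M\<close>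
  (\<open>ham_coords_on_real_locus\<close>).  Consequently the iterated derivatives along \<open>Y\<close> of the holomorphic
  coordinate functions \<open>z\<^sub>C\<close> restrict on \<open>M\<close> to \<open>\<tau>\<^sup>k X\<^sub>h\<^sup>k z\<close>, and the Taylor series at \<open>0\<close> of
  \<open>t \<mapsto> z\<^sub>C (\<eta> (- t) (\<iota> p))\<close> is the exponential series of \<open>t \<tau> X\<^sub>h\<close> applied to \<open>z\<close>, that is, the
  coordinates of \<open>\<phi> (t \<tau>) p\<close>.  The Cauchy estimates show that for small \<open>t\<close> this Taylor series
  converges to the function (\<open>taylor_along_integral_curve\<close>).  As \<open>\<pi>\<^sub>0\<close> is the projection to \<open>z\<^sub>C\<close>, this
  proves \<open>\<pi>\<^sub>0 \<circ> \<eta> (- t) \<circ> \<iota> = \<phi> (t \<tau>)\<close> near every point (\<open>flow_projects_to_exp_near\<close>), and on all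
  of \<open>M\<close> by compactness.

  The rest is formal.  By uniqueness of integral curves (\<open>integral_curve_unique\<close>) \<open>\<eta> t\<close> is injective,
  so the leaf of \<open>\<F>\<^sub>t\<close> through \<open>\<eta> t (\<iota> p)\<close> is the image of the fibre of \<open>\<pi>\<^sub>0\<close> over \<open>p\<close> and no other.
  It contains \<open>\<iota> p'\<close> exactly if \<open>\<eta> (- t) (\<iota> p')\<close> lies over \<open>p\<close>, which by the identity above means
  \<open>\<phi> (t \<tau>) p' = p\<close>.  So it meets \<open>M\<close> in the single point \<open>p' = inv (\<phi> (t \<tau>)) p\<close>.
\<close>

section \<open>Holomorphic functions of several complex variables\<close>

lemma norm_complex_vec_scale: "norm (a *s v) = cmod a * norm (v :: complex^'n)"
  by (simp add: norm_vec_def L2_set_def norm_mult power_mult_distrib real_sqrt_mult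
      flip: sum_distrib_left)

lemma complex_vec_scale_real: "complex_of_real r *s v = r *\<^sub>R (v :: complex^'n)"
  unfolding vec_eq_iff vector_smult_component vector_scaleR_component
  by (simp add: scaleR_conv_of_real)

lemma holo_on_has_derivative:
  assumes "holo_on S f" "x \<in> S"
  shows "(f has_derivative frechet_derivative f (at x)) (at x)"
  using assms unfolding holo_on_def
  by (metis differentiable_def frechet_derivative_works)

lemma holo_on_derivative_scale:
  assumes "holo_on S f" "x \<in> S"
  shows "frechet_derivative f (at x) (a *s v) = a * frechet_derivative f (at x) v"
  using assms unfolding holo_on_def
  by (metis frechet_derivative_at)

lemma holo_on_imp_continuous_on: "holo_on S f \<Longrightarrow> continuous_on S f"
  by (meson continuous_at_imp_continuous_on has_derivative_continuous holo_on_has_derivative)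

lemma holo_on_subset: "holo_on S f \<Longrightarrow> T \<subseteq> S \<Longrightarrow> holo_on T f"
  by (auto simp: holo_on_def)

lemma holo_on_transform_open:
  assumes "holo_on S f" "open S" "\<And>x. x \<in> S \<Longrightarrow> f x = g x"
  shows "holo_on S g"
  using assms unfolding holo_on_def
  by (metis has_derivative_transform_within_open)

lemma holo_on_const: "holo_on S (\<lambda>x. c)"
  unfolding holo_on_def by (auto intro!: exI[of _ "\<lambda>v. 0"])

lemma holo_on_component:
  fixes S :: "(complex^'n) set"
  shows "holo_on S (\<lambda>x. x $ i)"
proof -
  have "((\<lambda>x. x $ i) has_derivative (\<lambda>v. v $ i)) (at x)" for x :: "complex^'n"
    by (rule bounded_linear_imp_has_derivative) (rule bounded_linear_vec_nth)
  then show ?thesis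
    unfolding holo_on_def by (auto intro!: exI[of _ "\<lambda>v. v $ i"])
qed

lemma holo_on_add:
  assumes "holo_on S f" "holo_on S g"
  shows "holo_on S (\<lambda>x. f x + g x)"
  unfolding holo_on_def
proof
  fix x assume x: "x \<in> S"
  note f = holo_on_has_derivative[OF assms(1) x] and g = holo_on_has_derivative[OF assms(2) x]
  show "\<exists>D. ((\<lambda>x. f x + g x) has_derivative D) (at x) \<and> (\<forall>a v. D (a *s v) = a * D v)"
    by (rule exI, rule conjI, rule has_derivative_add[OF f g]) (auto simp: holo_on_derivative_scale[OF assms(1) x]
        holo_on_derivative_scale[OF assms(2) x] algebra_simps)
qed

lemma holo_on_mult:
  assumes "holo_on S f" "holo_on S g"
  shows "holo_on S (\<lambda>x. f x * g x)"
  unfolding holo_on_def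
proof
  fix x assume x: "x \<in> S"
  note f = holo_on_has_derivative[OF assms(1) x] and g = holo_on_has_derivative[OF assms(2) x]
  show "\<exists>D. ((\<lambda>x. f x * g x) has_derivative D) (at x) \<and> (\<forall>a v. D (a *s v) = a * D v)"
    by (rule exI, rule conjI, rule has_derivative_mult[OF f g]) (auto simp: holo_on_derivative_scale[OF assms(1) x]
        holo_on_derivative_scale[OF assms(2) x] algebra_simps)
qed

lemma holo_on_inverse:
  assumes "holo_on S f" "\<And>x. x \<in> S \<Longrightarrow> f x \<noteq> 0"
  shows "holo_on S (\<lambda>x. inverse (f x))"
  unfolding holo_on_def
proof
  fix x assume x: "x \<in> S"
  note f = holo_on_has_derivative[OF assms(1) x]
  show "\<exists>D. ((\<lambda>x. inverse (f x)) has_derivative D) (at x) \<and> (\<forall>a v. D (a *s v) = a * D v)"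
    by (rule exI, rule conjI, rule Deriv.has_derivative_inverse[OF assms(2)[OF x] f]) (auto simp: holo_on_derivative_scale[OF assms(1) x] algebra_simps)
qed

lemma holo_on_sum:
  "(\<And>i. i \<in> I \<Longrightarrow> holo_on S (f i)) \<Longrightarrow> holo_on S (\<lambda>x. \<Sum>i\<in>I. f i x)"
  by (induction I rule: infinite_finite_induct) (auto intro: holo_on_const holo_on_add)

lemma holo_on_prod:
  "(\<And>i. i \<in> I \<Longrightarrow> holo_on S (f i)) \<Longrightarrow> holo_on S (\<lambda>x. \<Prod>i\<in>I. f i x)"
  by (induction I rule: infinite_finite_induct) (auto intro: holo_on_const holo_on_mult)

lemma holo_on_det:
  assumes "\<And>i j. holo_on S (\<lambda>x. A x $ i $ j)"
  shows "holo_on S (\<lambda>x. det (A x))"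
  unfolding det_def by (intro holo_on_sum holo_on_mult holo_on_const holo_on_prod assms)

lemma derivative_complex_basis:
  assumes "holo_on S f" "x \<in> S"
  shows "frechet_derivative f (at x) v = (\<Sum>i\<in>UNIV. v $ i * frechet_derivative f (at x) (axis i 1))"
proof -
  have lin: "linear (frechet_derivative f (at x))"
    using holo_on_has_derivative[OF assms] by (rule has_derivative_linear)
  have "frechet_derivative f (at x) v = frechet_derivative f (at x) (\<Sum>i\<in>UNIV. v $ i *s axis i 1)"
    by (simp add: basis_expansion)
  then show ?thesis
    by (simp add: linear_sum[OF lin] holo_on_derivative_scale[OF assms])
qed

text \<open>The one-variable Cauchy inequality on the complex line through \<open>x\<close> in direction \<open>v\<close>.\<close>

lemma cauchy_estimate:
  fixes f :: "complex^'n \<Rightarrow> complex"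
  assumes f: "holo_on S f" and sub: "cball x r \<subseteq> S" and r: "0 < r"
    and M: "\<And>y. y \<in> cball x r \<Longrightarrow> cmod (f y) \<le> M"
  shows "cmod (frechet_derivative f (at x) v) \<le> M * norm v / r"
proof (cases "v = 0")
  case True
  have "x \<in> S" using sub r by auto
  then have "frechet_derivative f (at x) 0 = 0"
    using holo_on_derivative_scale[OF f, of x 0 0] by simp
  then show ?thesis using True by simp
next
  case False
  define g where "g z = f (x + z *s v)" for z
  define R where "R = r / norm v"
  have R: "R > 0" using False r by (simp add: R_def)
  have inS: "x + z *s v \<in> cball x r" if "z \<in> cball 0 R" for z
    using that False by (simp add: dist_norm norm_complex_vec_scale R_def field_simps)
  have bl: "bounded_linear (\<lambda>z. z *s v)"
    by (rule bounded_linear_intro[of _ "norm v"])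
      (auto simp: vec_eq_iff algebra_simps norm_complex_vec_scale)
  have der: "(g has_field_derivative frechet_derivative f (at (x + z *s v)) v) (at z)"
    if "z \<in> cball 0 R" for z
  proof -
    have "x + z *s v \<in> S" using inS[OF that] sub by auto
    note fd = holo_on_has_derivative[OF f this] and sc = holo_on_derivative_scale[OF f this]
    have "((\<lambda>z. x + z *s v) has_derivative (\<lambda>z. z *s v)) (at z)"
      by (auto intro!: derivative_eq_intros bounded_linear_imp_has_derivative bl)
    from has_derivative_compose[OF this fd]
    show ?thesis
      unfolding has_field_derivative_def g_def by (simp add: sc mult.commute[of _ "frechet_derivative f _ v"])
  qed
  have "cmod ((deriv ^^ 1) g 0) \<le> fact 1 * M / R ^ 1"
  proof (rule Cauchy_inequality)
    show "g holomorphic_on ball 0 R"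
      using der by (metis ball_subset_cball field_differentiable_at_within
          field_differentiable_def holomorphic_on_def subsetD)
    show "continuous_on (cball 0 R) g"
      using der by (meson DERIV_isCont continuous_at_imp_continuous_on)
    show "cmod (g z) \<le> M" if "cmod (0 - z) = R" for z
      using that inS[of z] M by (auto simp: g_def)
  qed (fact R)
  moreover have "deriv g 0 = frechet_derivative f (at x) v"
    using DERIV_imp_deriv[OF der[of 0]] R by simp
  ultimately show ?thesis by (simp add: R_def)
qed

text \<open>Weierstrass's theorem: the Cauchy estimate turns uniform convergence of the functions into uniform
  convergence of the derivatives.\<close>

lemma holo_on_uniform_limit:
  fixes F :: "nat \<Rightarrow> complex^'n \<Rightarrow> complex"
  assumes S: "open S" and F: "\<And>n. holo_on S (F n)" and lim: "uniform_limit S F g sequentially"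
  shows "holo_on S g"
  unfolding holo_on_def
proof
  fix x0 assume x0: "x0 \<in> S"
  then obtain e where e: "e > 0" "cball x0 e \<subseteq> S"
    using S open_contains_cball by blast
  define r where "r = e / 2"
  have r: "r > 0" using e by (simp add: r_def)
  have sub: "cball x r \<subseteq> S" if "x \<in> ball x0 r" for x
  proof
    fix y assume "y \<in> cball x r"
    then have "dist x0 y \<le> e"
      using that dist_triangle[of x0 y x] by (simp add: r_def)
    then show "y \<in> S" using e by auto
  qed
  have inS: "x \<in> S" if "x \<in> ball x0 r" for x
    using sub[OF that] r by auto
  let ?F' = "\<lambda>n x. frechet_derivative (F n) (at x)"
  have cauchy: "\<exists>N. \<forall>n\<ge>N. \<forall>m\<ge>N. \<forall>x\<in>ball x0 r. \<forall>h. cmod (?F' n x h - ?F' m x h) \<le> d * norm h"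
    if d: "d > 0" for d
  proof -
    have "d * r / 2 > 0" using d r by simp
    from uniform_limitD[OF lim this]
    obtain N where N: "\<And>n y. n \<ge> N \<Longrightarrow> y \<in> S \<Longrightarrow> dist (F n y) (g y) < d * r / 2"
      unfolding eventually_sequentially by blast
    have "cmod (?F' n x h - ?F' m x h) \<le> d * norm h"
      if nm: "n \<ge> N" "m \<ge> N" and x: "x \<in> ball x0 r" for n m x h
    proof -
      have h: "holo_on S (\<lambda>y. F n y + (- 1) * F m y)"
        by (intro holo_on_add holo_on_mult holo_on_const F)
      have "cmod (frechet_derivative (\<lambda>y. F n y + (- 1) * F m y) (at x) h) \<le> d * r * norm h / r"
      proof (rule cauchy_estimate[OF h sub[OF x] r])
        fix y assume "y \<in> cball x r"
        then have "y \<in> S" using sub[OF x] by auto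
        then have "dist (F n y) (F m y) < d * r"
          using N[OF nm(1), of y] N[OF nm(2), of y] dist_triangle2[of "F n y" "F m y" "g y"] by simp
        then show "cmod (F n y + (- 1) * F m y) \<le> d * r" by (simp add: dist_norm)
      qed
      moreover have "frechet_derivative (\<lambda>y. F n y + (- 1) * F m y) (at x) = (\<lambda>h. ?F' n x h - ?F' m x h)"
      proof -
        have "((\<lambda>y. F n y + (- 1) * F m y) has_derivative (\<lambda>h. ?F' n x h - ?F' m x h)) (at x)"
          using has_derivative_diff[OF holo_on_has_derivative[OF F inS[OF x]]
              holo_on_has_derivative[OF F inS[OF x]], of n m] by simp
        then show ?thesis by (rule frechet_derivative_at[symmetric])
      qed
      ultimately show ?thesis using r by simp
    qed
    then show ?thesis by blast
  qed
  define G where "G x h = lim (\<lambda>n. ?F' n x h)" for x h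
  have G: "(\<lambda>n. ?F' n x h) \<longlonglongrightarrow> G x h" if x: "x \<in> ball x0 r" for x h
  proof -
    have "Cauchy (\<lambda>n. ?F' n x h)"
    proof (rule metric_CauchyI)
      fix d :: real assume d: "d > 0"
      have "d / (norm h + 1) > 0" using d by (simp add: add_nonneg_pos)
      from cauchy[OF this] obtain N where
        "\<And>n m. n \<ge> N \<Longrightarrow> m \<ge> N \<Longrightarrow> cmod (?F' n x h - ?F' m x h) \<le> d / (norm h + 1) * norm h"
        using x by blast
      moreover have "d / (norm h + 1) * norm h < d"
        using d add_nonneg_pos[of "norm h" 1] by (simp add: divide_less_eq distrib_left)
      ultimately have "dist (?F' m x h) (?F' n x h) < d" if "m \<ge> N" "n \<ge> N" for m n
        using that unfolding dist_norm by (meson order_le_less_trans)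
      then show "\<exists>N. \<forall>m\<ge>N. \<forall>n\<ge>N. dist (?F' m x h) (?F' n x h) < d" by blast
    qed
    then show ?thesis
      unfolding G_def by (simp add: Cauchy_convergent_iff convergent_LIMSEQ_iff)
  qed
  have "\<exists>g'. \<forall>x\<in>ball x0 r. (\<lambda>n. F n x) \<longlonglongrightarrow> g' x \<and> (g' has_derivative G x) (at x within ball x0 r)"
  proof (rule has_derivative_sequence)
    show "convex (ball x0 r)" by simp
    show "(F n has_derivative ?F' n x) (at x within ball x0 r)" if "x \<in> ball x0 r" for n x
      using holo_on_has_derivative[OF F inS[OF that]] by (rule has_derivative_at_withinI)
    show "\<forall>\<^sub>F n in sequentially. \<forall>x\<in>ball x0 r. \<forall>h. cmod (?F' n x h - G x h) \<le> d * norm h"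
      if "d > 0" for d
    proof -
      obtain N where N: "\<And>n m x h. n \<ge> N \<Longrightarrow> m \<ge> N \<Longrightarrow> x \<in> ball x0 r \<Longrightarrow>
          cmod (?F' n x h - ?F' m x h) \<le> d * norm h"
        using cauchy[OF \<open>d > 0\<close>] by blast
      have "cmod (?F' n x h - G x h) \<le> d * norm h" if "n \<ge> N" "x \<in> ball x0 r" for n x h
      proof (rule Lim_bounded)
        show "(\<lambda>m. cmod (?F' n x h - ?F' m x h)) \<longlonglongrightarrow> cmod (?F' n x h - G x h)"
          by (intro tendsto_intros G that)
        show "\<forall>m\<ge>N. cmod (?F' n x h - ?F' m x h) \<le> d * norm h"
          using N that by blast
      qed
      then show ?thesis unfolding eventually_sequentially by blast
    qed
    show "x0 \<in> ball x0 r" using r by simp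
    show "(\<lambda>n. F n x0) \<longlonglongrightarrow> g x0"
      using tendsto_uniform_limitI[OF lim x0] .
  qed
  then obtain g' where g': "\<And>x. x \<in> ball x0 r \<Longrightarrow> (\<lambda>n. F n x) \<longlonglongrightarrow> g' x"
      "\<And>x. x \<in> ball x0 r \<Longrightarrow> (g' has_derivative G x) (at x within ball x0 r)"
    by blast
  have "g' x = g x" if "x \<in> ball x0 r" for x
    using LIMSEQ_unique[OF g'(1)[OF that] tendsto_uniform_limitI[OF lim inS[OF that]]] .
  moreover have x0r: "x0 \<in> ball x0 r" using r by simp
  moreover have "(g' has_derivative G x0) (at x0)"
    using g'(2)[OF x0r] at_within_open[OF x0r] by simp
  ultimately have "(g has_derivative G x0) (at x0)"
    using has_derivative_transform_within_open[of g' "G x0" x0 UNIV "ball x0 r" g] by auto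
  moreover have "G x0 (a *s v) = a * G x0 v" for a v
  proof (rule LIMSEQ_unique)
    show "(\<lambda>n. ?F' n x0 (a *s v)) \<longlonglongrightarrow> G x0 (a *s v)" by (rule G[OF x0r])
    show "(\<lambda>n. ?F' n x0 (a *s v)) \<longlonglongrightarrow> a * G x0 v"
      unfolding holo_on_derivative_scale[OF F x0] by (intro tendsto_intros G[OF x0r])
  qed
  ultimately show "\<exists>D. (g has_derivative D) (at x0) \<and> (\<forall>a v. D (a *s v) = a * D v)"
    by blast
qed

lemma holo_on_bounded_near:
  assumes "holo_on S f" "open S" "x \<in> S"
  obtains r M where "r > 0" "M > 0" "cball x r \<subseteq> S" "\<And>y. y \<in> cball x r \<Longrightarrow> cmod (f y) \<le> M"
proof -
  obtain r where r: "r > 0" "cball x r \<subseteq> S"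
    using assms(2,3) open_contains_cball by blast
  have "bounded (f ` cball x r)"
    by (meson assms(1) compact_cball compact_continuous_image compact_imp_bounded
        continuous_on_subset holo_on_imp_continuous_on r(2))
  then obtain M where "M > 0" "\<And>y. y \<in> cball x r \<Longrightarrow> cmod (f y) \<le> M"
    unfolding bounded_pos by blast
  with r show ?thesis by (rule_tac that)
qed

lemma cauchy_lipschitz:
  fixes f :: "complex^'n \<Rightarrow> complex"
  assumes f: "holo_on S f" and sub: "cball p (s + r) \<subseteq> S" and r: "0 < r"
    and M: "\<And>y. y \<in> cball p (s + r) \<Longrightarrow> cmod (f y) \<le> M"
    and x: "x \<in> cball p s" and y: "y \<in> cball p s"
  shows "cmod (f x - f y) \<le> M / r * norm (x - y)"
proof (rule differentiable_bound)
  have inc: "cball z r \<subseteq> cball p (s + r)" if "z \<in> cball p s" for z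
    using that by (simp add: cball_subset_cball_iff dist_commute)
  show "(f has_derivative frechet_derivative f (at z)) (at z within cball p s)"
    if "z \<in> cball p s" for z
  proof (rule has_derivative_at_withinI[OF holo_on_has_derivative[OF f]])
    show "z \<in> S" using inc[OF that] sub r by (meson centre_in_cball less_imp_le subsetD)
  qed
  show "onorm (frechet_derivative f (at z)) \<le> M / r" if "z \<in> cball p s" for z
  proof (rule onorm_le)
    show "cmod (frechet_derivative f (at z) v) \<le> M / r * norm v" for v
      using cauchy_estimate[OF f _ r, of z M v] inc[OF that] sub M by (auto simp: subset_iff)
  qed
qed (use x y in auto)

text \<open>The difference quotients of \<open>f\<close> in direction \<open>v\<close> are holomorphic, and they converge locally
  uniformly because the derivative is locally Lipschitz.  The latter is the Cauchy estimate for the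
  function \<open>z \<mapsto> f (z + (y - x)) - f z\<close>, which is small since \<open>f\<close> is locally Lipschitz.\<close>

lemma holo_on_frechet_derivative:
  fixes f :: "complex^'n \<Rightarrow> complex"
  assumes S: "open S" and f: "holo_on S f"
  shows "holo_on S (\<lambda>x. frechet_derivative f (at x) v)"
proof -
  let ?f' = "\<lambda>x. frechet_derivative f (at x)"
  have local: "\<exists>r>0. holo_on (ball x0 r) (\<lambda>x. ?f' x v)" if x0: "x0 \<in> S" for x0
  proof -
    obtain e M where e: "e > 0" "M > 0" "cball x0 e \<subseteq> S"
      and M: "\<And>y. y \<in> cball x0 e \<Longrightarrow> cmod (f y) \<le> M"
      using holo_on_bounded_near[OF f S x0] by metis
    define r where "r = e / 3"
    have r: "r > 0" using e by (simp add: r_def)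
    have lip: "cmod (f x - f y) \<le> M / r * norm (x - y)"
      if "x \<in> cball x0 (2 * r)" "y \<in> cball x0 (2 * r)" for x y
      by (rule cauchy_lipschitz[OF f, where p = x0 and s = "2 * r"])
        (use that e r M in \<open>auto simp: r_def\<close>)
    have inS: "x \<in> S" if "x \<in> cball x0 (2 * r)" for x
      using that e r by (auto simp: r_def)
    have lip': "cmod (?f' y h - ?f' x h) \<le> M / r * norm (y - x) / r * norm h"
      if x: "x \<in> cball x0 r" and y: "y \<in> cball x0 r" for x y h
    proof -
      define g where "g z = f (z + (y - x)) + (- 1) * f z" for z
      define T where "T = {z. z \<in> S \<and> z + (y - x) \<in> S}"
      have der: "(g has_derivative (\<lambda>h. ?f' (z + (y - x)) h - ?f' z h)) (at z)" if "z \<in> T" for z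
      proof -
        have "((\<lambda>z. z + (y - x)) has_derivative (\<lambda>h. h)) (at z)"
          by (auto intro!: derivative_eq_intros)
        from has_derivative_compose[OF this holo_on_has_derivative[OF f]]
        have "((\<lambda>z. f (z + (y - x))) has_derivative (\<lambda>h. ?f' (z + (y - x)) h)) (at z)"
          using that by (simp add: T_def)
        from has_derivative_diff[OF this holo_on_has_derivative[OF f]]
        show ?thesis using that by (simp add: T_def g_def[abs_def])
      qed
      have holo: "holo_on T g"
        unfolding holo_on_def
      proof
        fix z assume z: "z \<in> T"
        show "\<exists>D. (g has_derivative D) (at z) \<and> (\<forall>a v. D (a *s v) = a * D v)"
          using der[OF z] z by (rule_tac exI, rule_tac conjI)
            (auto simp: T_def holo_on_derivative_scale[OF f] algebra_simps)
      qed
      have near: "z \<in> cball x0 (2 * r) \<and> z + (y - x) \<in> cball x0 (2 * r)" if "z \<in> cball x r" for z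
      proof -
        have "dist x0 z \<le> dist x0 x + dist x z" by (rule dist_triangle)
        moreover have "dist x0 (z + (y - x)) \<le> dist x0 y + dist y (z + (y - x))" by (rule dist_triangle)
        moreover have "dist y (z + (y - x)) = dist x z" by (simp add: dist_norm)
        ultimately show ?thesis using that x y by auto
      qed
      have "cmod (frechet_derivative g (at x) h) \<le> M / r * norm (y - x) * norm h / r"
      proof (rule cauchy_estimate[OF holo _ r])
        show "cball x r \<subseteq> T" using near inS by (auto simp: T_def)
        show "cmod (g z) \<le> M / r * norm (y - x)" if "z \<in> cball x r" for z
          using lip[of "z + (y - x)" z] near[OF that] by (simp add: g_def)
      qed
      moreover have "x \<in> T" using near[of x] inS r by (simp add: T_def)
      then have "frechet_derivative g (at x) h = ?f' y h - ?f' x h"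
        using fun_cong[OF frechet_derivative_at[OF der[of x]], of h] by simp
      ultimately show ?thesis by (simp add: field_simps)
    qed
    \<comment> \<open>Start late enough that the translates stay in the ball where the Lipschitz bound holds.\<close>
    obtain n0 :: nat where n0: "2 * norm v / r < real n0" using reals_Archimedean2 by blast
    have n0': "n0 > 0" using n0 r by (metis divide_nonneg_pos gr0I mult_nonneg_nonneg norm_ge_zero not_less of_nat_0 zero_le_numeral)
    define N where "N n = real (n + n0)" for n
    have N: "N n > 0" "norm v / N n \<le> r / 2" for n
    proof -
      show p: "N n > 0" using n0' by (simp add: N_def)
      have "2 * norm v / r \<le> N n" using n0 by (simp add: N_def)
      then show "norm v / N n \<le> r / 2" using p r by (simp add: field_simps)
    qed
    define F where "F n x = complex_of_real (N n) * (f (x + (1 / N n) *\<^sub>R v) + (- 1) * f x)" for n x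
    have shift: "x + (1 / N n) *\<^sub>R v \<in> cball x0 r" if "x \<in> ball x0 (r / 2)" for n x
    proof -
      have "dist x0 (x + (1 / N n) *\<^sub>R v) \<le> dist x0 x + dist x (x + (1 / N n) *\<^sub>R v)"
        by (rule dist_triangle)
      also have "dist x (x + (1 / N n) *\<^sub>R v) = norm v / N n"
        using N(1)[of n] by (simp add: dist_norm)
      finally show ?thesis using N(2)[of n] that unfolding mem_ball mem_cball by linarith
    qed
    have close: "cmod (F n x - ?f' x v) \<le> (M / r / r * norm v * norm v) / N n" if x: "x \<in> ball x0 (r / 2)" for n x
    proof -
      let ?b = "x + (1 / N n) *\<^sub>R v"
      have xr: "x \<in> cball x0 r" using x r by auto
      have "cmod (f ?b - f x - ?f' x (?b - x)) \<le> norm (?b - x) * (M / r * (norm v / N n) / r)"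
      proof (rule differentiable_bound_linearization[where S = "cball x0 r \<inter> cball x (norm v / N n)" and f' = ?f'])
        have "convex (cball x0 r \<inter> cball x (norm v / N n))" by (intro convex_Int convex_cball)
        moreover have "x \<in> cball x0 r \<inter> cball x (norm v / N n)" using xr N(1)[of n] by simp
        moreover have "?b \<in> cball x0 r \<inter> cball x (norm v / N n)"
          using shift[OF x, of n] N(1)[of n] by (simp add: dist_norm)
        ultimately have "(1 - t) *\<^sub>R x + t *\<^sub>R ?b \<in> cball x0 r \<inter> cball x (norm v / N n)" if "t \<in> {0..1}" for t
          using that by (intro convexD_alt) auto
        then show "x + t *\<^sub>R (?b - x) \<in> cball x0 r \<inter> cball x (norm v / N n)" if "t \<in> {0..1}" for t
          using that by (simp add: algebra_simps)
        show "(f has_derivative ?f' z) (at z within cball x0 r \<inter> cball x (norm v / N n))"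
          if "z \<in> cball x0 r \<inter> cball x (norm v / N n)" for z
          using that inS[of z] r by (intro has_derivative_at_withinI[OF holo_on_has_derivative[OF f]]) auto
        show "onorm (?f' z - ?f' x) \<le> M / r * (norm v / N n) / r"
          if z: "z \<in> cball x0 r \<inter> cball x (norm v / N n)" for z
        proof (rule onorm_le)
          fix h
          have "cmod (?f' z h - ?f' x h) \<le> M / r * norm (z - x) / r * norm h"
            using lip'[OF xr, of z h] z by simp
          also have "\<dots> \<le> M / r * (norm v / N n) / r * norm h"
            using z e r by (intro mult_right_mono divide_right_mono mult_left_mono)
              (auto simp: dist_norm norm_minus_commute)
          finally show "cmod ((?f' z - ?f' x) h) \<le> M / r * (norm v / N n) / r * norm h" by simp
        qed
        show "x \<in> cball x0 r \<inter> cball x (norm v / N n)" by fact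
      qed
      then have "N n * cmod (f ?b - f x - ?f' x (?b - x)) \<le> N n * (norm (?b - x) * (M / r * (norm v / N n) / r))"
        using N(1)[of n] by (intro mult_left_mono) auto
      also have "\<dots> = (M / r / r * norm v * norm v) / N n"
        using N(1)[of n] by (simp add: field_simps)
      also have "N n * cmod (f ?b - f x - ?f' x (?b - x)) = cmod (F n x - ?f' x v)"
      proof -
        have "?f' x (?b - x) = ?f' x (complex_of_real (1 / N n) *s v)"
          by (simp only: complex_vec_scale_real) simp
        also have "\<dots> = complex_of_real (1 / N n) * ?f' x v"
          using inS[of x] xr r by (intro holo_on_derivative_scale[OF f]) auto
        finally have eq: "F n x - ?f' x v = complex_of_real (N n) * (f ?b - f x - ?f' x (?b - x))"
          using N(1)[of n] by (simp add: F_def algebra_simps)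
        show ?thesis unfolding eq norm_mult using N(1)[of n] by simp
      qed
      finally show ?thesis .
    qed
    have "holo_on (ball x0 (r / 2)) (\<lambda>x. ?f' x v)"
    proof (rule holo_on_uniform_limit)
      show "holo_on (ball x0 (r / 2)) (F n)" for n
      proof -
        have sh: "holo_on (ball x0 (r / 2)) (\<lambda>x. f (x + (1 / N n) *\<^sub>R v))"
          unfolding holo_on_def
        proof
          fix x assume "x \<in> ball x0 (r / 2)"
          then have xS: "x + (1 / N n) *\<^sub>R v \<in> S"
            using inS[of "x + (1 / N n) *\<^sub>R v"] shift[of x n] r by auto
          have "((\<lambda>x. x + (1 / N n) *\<^sub>R v) has_derivative (\<lambda>h. h)) (at x)"
            by (auto intro!: derivative_eq_intros)
          from has_derivative_compose[OF this holo_on_has_derivative[OF f xS]]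
          show "\<exists>D. ((\<lambda>x. f (x + (1 / N n) *\<^sub>R v)) has_derivative D) (at x) \<and> (\<forall>a v. D (a *s v) = a * D v)"
            using holo_on_derivative_scale[OF f xS] by auto
        qed
        have "ball x0 (r / 2) \<subseteq> S" using inS r by auto
        then show ?thesis
          unfolding F_def
          by (intro holo_on_mult holo_on_add holo_on_const sh holo_on_subset[OF f])
      qed
      show "uniform_limit (ball x0 (r / 2)) F (\<lambda>x. ?f' x v) sequentially"
      proof (rule uniform_limitI)
        fix d :: real assume d: "d > 0"
        define C where "C = M / r / r * norm v * norm v"
        obtain k :: nat where k: "C / d < real k" using reals_Archimedean2 by blast
        have "dist (F n x) (?f' x v) < d" if "n \<ge> k" "x \<in> ball x0 (r / 2)" for n x
        proof -
          have "C / d < N n" using k that by (simp add: N_def)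
          then have "C / N n < d" using N(1)[of n] d by (simp add: field_simps)
          then show ?thesis using close[OF that(2), of n] by (simp add: dist_norm C_def)
        qed
        then show "\<forall>\<^sub>F n in sequentially. \<forall>x\<in>ball x0 (r / 2). dist (F n x) (?f' x v) < d"
          unfolding eventually_sequentially by blast
      qed
    qed simp
    then show ?thesis using r by (metis half_gt_zero)
  qed
  show ?thesis
    unfolding holo_on_def
  proof
    fix x assume "x \<in> S"
    then obtain r where "r > 0" "holo_on (ball x r) (\<lambda>x. ?f' x v)" using local by blast
    then show "\<exists>D. ((\<lambda>x. ?f' x v) has_derivative D) (at x) \<and> (\<forall>a v. D (a *s v) = a * D v)"
      unfolding holo_on_def by simp
  qed
qed

section \<open>Taylor series along integral curves of a holomorphic vector field\<close>

definition deriv_along :: "(complex^'n \<Rightarrow> complex^'n) \<Rightarrow> (complex^'n \<Rightarrow> complex) \<Rightarrow> complex^'n \<Rightarrow> complex" where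
  "deriv_along Y f x = frechet_derivative f (at x) (Y x)"

lemma holo_on_deriv_along:
  assumes S: "open S" and f: "holo_on S f" and Y: "holo_map_on S Y"
  shows "holo_on S (deriv_along Y f)"
proof (rule holo_on_transform_open[OF _ S])
  show "holo_on S (\<lambda>x. \<Sum>i\<in>UNIV. Y x $ i * frechet_derivative f (at x) (axis i 1))"
  proof (rule holo_on_sum, rule holo_on_mult)
    show "holo_on S (\<lambda>x. Y x $ i)" for i
      using Y by (simp add: holo_map_on_def)
    show "holo_on S (\<lambda>x. frechet_derivative f (at x) (axis i 1))" for i
      by (rule holo_on_frechet_derivative[OF S f])
  qed
  show "(\<Sum>i\<in>UNIV. Y x $ i * frechet_derivative f (at x) (axis i 1)) = deriv_along Y f x"
    if "x \<in> S" for x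
    unfolding deriv_along_def by (rule derivative_complex_basis[OF f that, symmetric])
qed

lemma holo_on_deriv_along_iterate:
  assumes "open S" "holo_on S f" "holo_map_on S Y"
  shows "holo_on S ((deriv_along Y ^^ k) f)"
  by (induction k) (auto intro: holo_on_deriv_along assms)

text \<open>Each derivative costs one Cauchy estimate; sharing the radius \<open>R\<close> equally among the \<open>k\<close>
  steps gives the factor \<open>k\<^sup>k\<close>, which \<open>fact k\<close> will absorb up to \<open>exp k\<close>.\<close>

lemma deriv_along_iterate_bound:
  fixes Y :: "complex^'n \<Rightarrow> complex^'n"
  assumes S: "open S" and f: "holo_on S f" and Y: "holo_map_on S Y"
    and sub: "cball a (r + R) \<subseteq> S" and R: "R > 0"
    and M: "\<And>y. y \<in> cball a (r + R) \<Longrightarrow> cmod (f y) \<le> M"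
    and K: "\<And>y. y \<in> cball a (r + R) \<Longrightarrow> norm (Y y) \<le> K"
    and x: "x \<in> cball a r"
  shows "cmod ((deriv_along Y ^^ k) f x) \<le> M * (real k * K / R) ^ k"
proof (cases "k = 0")
  case True
  then show ?thesis using M[of x] x R by auto
next
  case False
  define d where "d = R / real k"
  have d: "d > 0" using R False by (simp add: d_def)
  have "cmod ((deriv_along Y ^^ j) f y) \<le> M * (K / d) ^ j"
    if "j \<le> k" "y \<in> cball a (r + R - real j * d)" for j y
    using that
  proof (induction j arbitrary: y)
    case 0
    then show ?case using M by simp
  next
    case (Suc j)
    have near: "cball y d \<subseteq> cball a (r + R - real j * d)"
      using Suc.prems(2) by (simp add: cball_subset_cball_iff algebra_simps dist_commute)
    also have "\<dots> \<subseteq> cball a (r + R)" using d by (simp add: cball_subset_cball_iff)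
    finally have near': "cball y d \<subseteq> cball a (r + R)" .
    have bound: "cmod ((deriv_along Y ^^ j) f z) \<le> M * (K / d) ^ j" if "z \<in> cball y d" for z
      using Suc.IH[of z] Suc.prems(1) that near by auto
    have "cmod (deriv_along Y ((deriv_along Y ^^ j) f) y) \<le> M * (K / d) ^ j * norm (Y y) / d"
      unfolding deriv_along_def[of Y "(deriv_along Y ^^ j) f"]
      using near' sub by (intro cauchy_estimate[OF holo_on_deriv_along_iterate[OF S f Y] _ d bound]) auto
    also have "\<dots> \<le> M * (K / d) ^ j * K / d"
    proof (intro divide_right_mono mult_left_mono)
      have "0 \<le> cmod ((deriv_along Y ^^ j) f y)" by simp
      also have "\<dots> \<le> M * (K / d) ^ j" using d by (intro bound) auto
      finally show "0 \<le> M * (K / d) ^ j" .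
      show "norm (Y y) \<le> K" using subsetD[OF near', of y] d by (intro K) simp
    qed (use d in simp)
    finally show ?case by (simp add: mult_ac)
  qed
  from this[of k x] show ?thesis
    using x False R by (simp add: d_def field_simps)
qed

text \<open>\<open>n\<^sup>n / n!\<close> is one of the terms of the series of \<open>exp n\<close>.\<close>

lemma power_self_le_exp_fact: "real n ^ n \<le> exp 1 ^ n * fact n"
proof -
  have "(\<Sum>k\<in>{n}. real n ^ k /\<^sub>R fact k) \<le> exp (real n)"
    unfolding exp_def by (rule sum_le_suminf[OF summable_exp_generic]) auto
  then show ?thesis
    by (simp add: field_simps exp_of_nat_mult[of n 1, simplified])
qed

text \<open>Taylor's formula: the \<open>k\<close>-th derivative of \<open>f\<close> along an integral curve of \<open>Y\<close> is
  \<open>(deriv_along Y ^^ k) f\<close>, so the bound above makes the remainder geometrically small.\<close>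

lemma taylor_along_integral_curve:
  fixes Y :: "complex^'n \<Rightarrow> complex^'n" and x :: "real \<Rightarrow> complex^'n"
  assumes S: "open S" and f: "holo_on S f" and Y: "holo_map_on S Y"
    and sub: "cball a (r + R) \<subseteq> S" and R: "R > 0"
    and M: "\<And>y. y \<in> cball a (r + R) \<Longrightarrow> cmod (f y) \<le> M"
    and K: "\<And>y. y \<in> cball a (r + R) \<Longrightarrow> norm (Y y) \<le> K"
    and x: "\<And>s. \<bar>s\<bar> < \<delta> \<Longrightarrow> x s \<in> cball a r"
    and x': "\<And>s. \<bar>s\<bar> < \<delta> \<Longrightarrow> (x has_vector_derivative Y (x s)) (at s)"
    and t: "\<bar>t\<bar> < \<delta>" and small: "exp 1 * K * \<bar>t\<bar> < R"
  shows "(\<lambda>k. of_real t ^ k / fact k * (deriv_along Y ^^ k) f (x 0)) sums f (x t)"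
proof -
  let ?D = "\<lambda>k. (deriv_along Y ^^ k) f"
  define q where "q = exp 1 * K * \<bar>t\<bar> / R"
  have xa: "x 0 \<in> cball a (r + R)" using x[of 0] t R by force
  have M0: "0 \<le> M" using M[OF xa] order_trans[OF norm_ge_zero] by blast
  have K0: "0 \<le> K" using K[OF xa] order_trans[OF norm_ge_zero] by blast
  have q: "0 \<le> q" "q < 1" using small R K0 by (auto simp: q_def)
  have xS: "x s \<in> S" if "\<bar>s\<bar> < \<delta>" for s using x[OF that] sub R by auto
  \<comment> \<open>The Lagrange remainder needs real values, so real and imaginary parts are treated separately.\<close>
  have real_part: "(\<lambda>k. p (of_real t ^ k / fact k * ?D k (x 0))) sums p (f (x t))"
    if p: "bounded_linear p" and p1: "\<And>z. \<bar>p z\<bar> \<le> cmod z" for p :: "complex \<Rightarrow> real"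
  proof -
    let ?d = "\<lambda>k s. p (?D k (x s))"
    have der: "DERIV (?d k) s :> ?d (Suc k) s" if "\<bar>s\<bar> < \<delta>" for k s
    proof -
      have D: "(?D k has_derivative frechet_derivative (?D k) (at (x s))) (at (x s))"
        using holo_on_has_derivative[OF holo_on_deriv_along_iterate[OF S f Y] xS[OF that]] .
      have "((\<lambda>s. ?D k (x s)) has_vector_derivative ?D (Suc k) (x s)) (at s)"
        using has_derivative_compose[OF x'[OF that, unfolded has_vector_derivative_def] D]
        by (simp add: has_vector_derivative_def deriv_along_def linear_cmul[OF has_derivative_linear[OF D]])
      from bounded_linear.has_vector_derivative[OF p this]
      show ?thesis by (simp add: has_real_derivative_iff_has_vector_derivative)
    qed
    have summand: "p (of_real t ^ k / fact k * ?D k (x 0)) = ?d k 0 / fact k * t ^ k" for k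
    proof -
      have "of_real t ^ k / fact k * ?D k (x 0) = (t ^ k / fact k) *\<^sub>R ?D k (x 0)"
        by (simp add: scaleR_conv_of_real)
      then show ?thesis using linear_cmul[OF bounded_linear.linear[OF p]] by simp
    qed
    have rem: "\<bar>p (f (x t)) - (\<Sum>k<n. ?d k 0 / fact k * t ^ k)\<bar> \<le> M * q ^ n" for n
    proof -
      obtain s where s: "\<bar>s\<bar> \<le> \<bar>t\<bar>"
        "p (f (x t)) = (\<Sum>k<n. ?d k 0 / fact k * t ^ k) + ?d n s / fact n * t ^ n"
        using Maclaurin_bi_le[of ?d "\<lambda>s. p (f (x s))" n t] der t by auto
      have "\<bar>?d n s\<bar> \<le> M * (real n * K / R) ^ n"
        using p1 deriv_along_iterate_bound[OF S f Y sub R M K x[of s]] s(1) t order_trans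
        by (metis order_le_less_trans)
      then have "\<bar>?d n s / fact n * t ^ n\<bar> \<le> M * (real n * K / R) ^ n / fact n * \<bar>t\<bar> ^ n"
        by (simp add: abs_mult power_abs divide_right_mono mult_right_mono)
      also have "\<dots> = M * (K * \<bar>t\<bar> / R) ^ n * (real n ^ n / fact n)"
        by (simp add: power_mult_distrib power_divide)
      also have "\<dots> \<le> M * (K * \<bar>t\<bar> / R) ^ n * exp 1 ^ n"
        using M0 K0 R power_self_le_exp_fact[of n]
        by (intro mult_left_mono mult_nonneg_nonneg zero_le_power) (auto simp: divide_le_eq)
      also have "\<dots> = M * q ^ n"
        by (simp add: q_def power_mult_distrib power_divide)
      finally show ?thesis using s(2) by simp
    qed
    have "(\<lambda>n. \<Sum>k<n. ?d k 0 / fact k * t ^ k) \<longlonglongrightarrow> p (f (x t))"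
    proof (rule LIM_zero_cancel, rule tendsto_rabs_zero_cancel, 
        rule tendsto_sandwich[where f = "\<lambda>n. 0" and h = "\<lambda>n. M * q ^ n"])
      show "(\<lambda>n. M * q ^ n) \<longlonglongrightarrow> 0"
        using tendsto_mult[OF tendsto_const LIMSEQ_power_zero[of q], of M] q by simp
      show "\<forall>\<^sub>F n in sequentially. \<bar>(\<Sum>k<n. ?d k 0 / fact k * t ^ k) - p (f (x t))\<bar> \<le> M * q ^ n"
        using rem by (auto simp: abs_minus_commute)
    qed auto
    then show ?thesis unfolding sums_def summand .
  qed
  show ?thesis
    unfolding sums_complex_iff
    using real_part[OF bounded_linear_Re abs_Re_le_cmod] real_part[OF bounded_linear_Im abs_Im_le_cmod]
    by blast
qed

section \<open>Integral curves on manifolds\<close>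

lemma param_coord: "is_chart c \<Longrightarrow> p \<in> chart_dom c \<Longrightarrow> param c (coord c p) = p"
  unfolding is_chart_def by (metis homeomorphism_apply1)

lemma coord_param: "is_chart c \<Longrightarrow> x \<in> chart_img c \<Longrightarrow> coord c (param c x) = x"
  unfolding is_chart_def by (metis homeomorphism_apply2)

lemma param_in_chart_dom: "is_chart c \<Longrightarrow> x \<in> chart_img c \<Longrightarrow> param c x \<in> chart_dom c"
  unfolding is_chart_def homeomorphism_def by (metis imageI)

lemma coord_inject:
  "is_chart c \<Longrightarrow> p \<in> chart_dom c \<Longrightarrow> q \<in> chart_dom c \<Longrightarrow> coord c p = coord c q \<Longrightarrow> p = q"
  by (metis param_coord)

lemma continuous_on_coord: "is_chart c \<Longrightarrow> continuous_on (chart_dom c) (coord c)"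
  unfolding is_chart_def homeomorphism_def by blast

lemma continuous_on_param: "is_chart c \<Longrightarrow> continuous_on (chart_img c) (param c)"
  unfolding is_chart_def homeomorphism_def by blast

lemma open_coord_preimage:
  "is_chart c \<Longrightarrow> open T \<Longrightarrow> open {p \<in> chart_dom c. coord c p \<in> T}"
  using continuous_open_preimage[OF continuous_on_coord, of c T]
  by (simp add: is_chart_def vimage_def Int_def)

lemma open_coord_image:
  assumes "is_chart c" "open U"
  shows "open (coord c ` (chart_dom c \<inter> U))"
proof -
  have "coord c ` (chart_dom c \<inter> U) = chart_img c \<inter> param c -` U"
    using assms(1) by (force simp: param_coord coord_param param_in_chart_dom)
  moreover have "open (chart_img c)" using assms(1) by (simp add: is_chart_def)
  ultimately show ?thesis
    using continuous_open_preimage[OF continuous_on_param[OF assms(1)] _ assms(2)] by simp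
qed

lemma mfd_structure_is_chart: "mfd_structure K A \<Longrightarrow> c \<in> A \<Longrightarrow> is_chart c"
  unfolding mfd_structure_def max_atlas_def by blast

lemma mfd_structure_covers: "mfd_structure K A \<Longrightarrow> \<exists>c\<in>A. p \<in> chart_dom c"
  unfolding mfd_structure_def by blast

text \<open>Where the difference of the two solutions is largest, the mean value inequality bounds it by
  \<open>L * d < 1\<close> times itself.\<close>

lemma ode_unique_local:
  fixes x y :: "real \<Rightarrow> 'a::real_normed_vector"
  assumes lip: "\<And>u v. u \<in> B \<Longrightarrow> v \<in> B \<Longrightarrow> norm (F u - F v) \<le> L * norm (u - v)"
    and L: "L \<ge> 0" "L * d < 1"
    and x: "\<And>t. t \<in> cball t0 d \<Longrightarrow> x t \<in> B \<and> (x has_vector_derivative F (x t)) (at t)"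
    and y: "\<And>t. t \<in> cball t0 d \<Longrightarrow> y t \<in> B \<and> (y has_vector_derivative F (y t)) (at t)"
    and eq: "x t0 = y t0" and t: "t \<in> cball t0 d"
  shows "x t = y t"
proof -
  define u where "u s = x s - y s" for s
  have t0: "t0 \<in> cball t0 d" using t by (auto intro: order_trans[OF zero_le_dist])
  have der: "(u has_derivative (\<lambda>h. h *\<^sub>R (F (x s) - F (y s)))) (at s within cball t0 d)"
    if "s \<in> cball t0 d" for s
    using has_vector_derivative_diff[of x "F (x s)" "at s" y "F (y s)"] x[OF that] y[OF that]
    unfolding u_def[abs_def] has_vector_derivative_def by (blast intro: has_derivative_at_withinI)
  have "continuous_on (cball t0 d) (\<lambda>s. norm (u s))"
    using der by (intro continuous_on_norm has_derivative_continuous_on)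
  then obtain s where s: "s \<in> cball t0 d" and max: "\<And>s'. s' \<in> cball t0 d \<Longrightarrow> norm (u s') \<le> norm (u s)"
    using continuous_attains_sup[OF compact_cball, of t0 d "\<lambda>s. norm (u s)"] t0 by blast
  have "norm (u s - u t0) \<le> L * norm (u s) * norm (s - t0)"
  proof (rule differentiable_bound[OF convex_cball der])
    show "onorm (\<lambda>h. h *\<^sub>R (F (x s') - F (y s'))) \<le> L * norm (u s)" if "s' \<in> cball t0 d" for s'
    proof (rule onorm_le)
      fix h :: real
      have "norm (F (x s') - F (y s')) \<le> L * norm (u s')"
        using lip x y that by (simp add: u_def)
      also have "\<dots> \<le> L * norm (u s)" using L max[OF that] by (simp add: mult_left_mono)
      finally show "norm (h *\<^sub>R (F (x s') - F (y s'))) \<le> L * norm (u s) * norm h"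
        by (simp add: mult.commute[of _ "\<bar>h\<bar>"] mult_left_mono)
    qed
  qed (use s t0 in auto)
  also have "\<dots> \<le> L * norm (u s) * d"
    using s L by (intro mult_left_mono) (auto simp: dist_norm norm_minus_commute)
  finally have "norm (u s) \<le> L * d * norm (u s)" by (simp add: u_def eq mult_ac)
  then have "norm (u s) \<le> 0" using L(2)
    by (metis linorder_not_le mult_less_cancel_right2)
  then show ?thesis using max[OF t] by (simp add: u_def)
qed

definition locally_lipschitz_vf :: "('m, 'e::euclidean_space) chart set \<Rightarrow> ('m, 'e) vfield \<Rightarrow> bool" where
  "locally_lipschitz_vf A X \<longleftrightarrow> (\<forall>c\<in>A. \<forall>p\<in>chart_dom c. \<exists>r>0. \<exists>L.
     \<forall>u\<in>cball (coord c p) r. \<forall>v\<in>cball (coord c p) r.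
       norm (X c (param c u) - X c (param c v)) \<le> L * norm (u - v))"

text \<open>The set where the curves agree is closed in \<open>I\<close> by the Hausdorff property and open by local
  uniqueness.\<close>

lemma integral_curve_unique:
  fixes \<gamma> \<gamma>' :: "real \<Rightarrow> 'm::t2_space" and A :: "('m, 'e::euclidean_space) chart set"
  assumes A: "mfd_structure K A" and X: "locally_lipschitz_vf A X"
    and I: "open I" "connected I"
    and \<gamma>: "integral_curve_on A X I \<gamma>" and \<gamma>': "integral_curve_on A X I \<gamma>'"
    and s: "s \<in> I" "\<gamma> s = \<gamma>' s" and t: "t \<in> I"
  shows "\<gamma> t = \<gamma>' t"
proof (rule ccontr)
  assume neq: "\<gamma> t \<noteq> \<gamma>' t"
  have cont: "continuous_on I \<gamma>" "continuous_on I \<gamma>'"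
    using \<gamma> \<gamma>' by (auto simp: integral_curve_on_def)
  let ?E = "{t \<in> I. \<gamma> t = \<gamma>' t}" and ?N = "{t \<in> I. \<gamma> t \<noteq> \<gamma>' t}"
  have "open ?N"
  proof (subst open_subopen, intro ballI)
    fix t assume t: "t \<in> ?N"
    then obtain U V where UV: "open U" "open V" "\<gamma> t \<in> U" "\<gamma>' t \<in> V" "U \<inter> V = {}"
      using hausdorff[of "\<gamma> t" "\<gamma>' t"] by blast
    have "open ((I \<inter> \<gamma> -` U) \<inter> (I \<inter> \<gamma>' -` V))"
      using cont I UV by (intro open_Int continuous_open_preimage)
    then show "\<exists>T. open T \<and> t \<in> T \<and> T \<subseteq> ?N"
      by (rule_tac exI[of _ "(I \<inter> \<gamma> -` U) \<inter> (I \<inter> \<gamma>' -` V)"]) (use t UV in auto)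
  qed
  moreover have "open ?E"
  proof (subst open_subopen, intro ballI)
    fix t0 assume t0: "t0 \<in> ?E"
    obtain c where c: "c \<in> A" "\<gamma> t0 \<in> chart_dom c" using mfd_structure_covers[OF A] by blast
    note ch = mfd_structure_is_chart[OF A c(1)]
    obtain r L where r: "r > 0"
      and L: "\<And>u v. u \<in> cball (coord c (\<gamma> t0)) r \<Longrightarrow> v \<in> cball (coord c (\<gamma> t0)) r \<Longrightarrow>
          norm (X c (param c u) - X c (param c v)) \<le> L * norm (u - v)"
      using X c unfolding locally_lipschitz_vf_def by metis
    define L' where "L' = \<bar>L\<bar> + 1"
    have L': "L' > 0" by (simp add: L'_def)
    let ?O = "{q \<in> chart_dom c. coord c q \<in> ball (coord c (\<gamma> t0)) r}"
    have "open ((I \<inter> \<gamma> -` ?O) \<inter> (I \<inter> \<gamma>' -` ?O))"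
      using cont I open_coord_preimage[OF ch, of "ball (coord c (\<gamma> t0)) r"]
      by (intro open_Int continuous_open_preimage) auto
    moreover have "t0 \<in> (I \<inter> \<gamma> -` ?O) \<inter> (I \<inter> \<gamma>' -` ?O)"
      using t0 c r by auto
    ultimately obtain e where e: "e > 0" "cball t0 e \<subseteq> (I \<inter> \<gamma> -` ?O) \<inter> (I \<inter> \<gamma>' -` ?O)"
      using open_contains_cball by blast
    define d where "d = min e (1 / (2 * L'))"
    have d: "d > 0" "cball t0 d \<subseteq> cball t0 e" "L' * d < 1"
    proof -
      show "d > 0" "cball t0 d \<subseteq> cball t0 e" using e L' by (auto simp: d_def)
      have "L' * d \<le> L' * (1 / (2 * L'))" using L' by (intro mult_left_mono) (auto simp: d_def)
      then show "L' * d < 1" using L' by simp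
    qed
    have coords: "coord c (\<beta> u) \<in> cball (coord c (\<gamma> t0)) r \<and>
        ((\<lambda>u. coord c (\<beta> u)) has_vector_derivative X c (param c (coord c (\<beta> u)))) (at u)"
      if "\<beta> \<in> {\<gamma>, \<gamma>'}" "u \<in> cball t0 d" for \<beta> u
    proof -
      have "u \<in> I" "\<beta> u \<in> ?O" using that d e by auto
      moreover have "integral_curve_on A X I \<beta>" using that \<gamma> \<gamma>' by auto
      ultimately show ?thesis
        unfolding integral_curve_on_def using c(1) by (auto simp: param_coord[OF ch])
    qed
    have "\<gamma> u = \<gamma>' u" if u: "u \<in> cball t0 d" for u
    proof (rule coord_inject[OF ch])
      show "\<gamma> u \<in> chart_dom c" "\<gamma>' u \<in> chart_dom c" using u d e by auto
      show "coord c (\<gamma> u) = coord c (\<gamma>' u)"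
      proof (rule ode_unique_local[where B = "cball (coord c (\<gamma> t0)) r" and F = "\<lambda>v. X c (param c v)"])
        show "norm (X c (param c u) - X c (param c v)) \<le> L' * norm (u - v)"
          if "u \<in> cball (coord c (\<gamma> t0)) r" "v \<in> cball (coord c (\<gamma> t0)) r" for u v
        proof -
          have "L * norm (u - v) \<le> L' * norm (u - v)"
            by (intro mult_right_mono) (auto simp: L'_def)
          then show ?thesis using L[OF that] by linarith
        qed
        show "coord c (\<gamma> t0) = coord c (\<gamma>' t0)" using t0 by simp
      qed (use coords u d L' in auto)
    qed
    then have "ball t0 d \<subseteq> ?E" using d e by (auto dest!: subsetD)
    then show "\<exists>T. open T \<and> t0 \<in> T \<and> T \<subseteq> ?E"
      using d by (intro exI[of _ "ball t0 d"]) auto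
  qed
  ultimately have "?E \<inter> I = {} \<or> ?N \<inter> I = {}"
    using connectedD[OF I(2), of ?E ?N] by blast
  then show False using s t neq by blast
qed

text \<open>Until it leaves the ball of radius \<open>R1\<close>, the curve moves with speed at most \<open>K\<close>, so that
  it is confined to a compact set inside that ball; hence there is no first exit time.\<close>

lemma curve_confined:
  fixes \<gamma> :: "real \<Rightarrow> 'm::t2_space" and c :: "('m, 'e::euclidean_space) chart"
  assumes ch: "is_chart c" and sub: "cball a R1 \<subseteq> chart_img c"
    and cont: "continuous_on {0..T} \<gamma>"
    and der: "\<And>t. t \<in> {0..T} \<Longrightarrow> \<gamma> t \<in> chart_dom c \<Longrightarrow>
        ((\<lambda>s. coord c (\<gamma> s)) has_vector_derivative v t) (at t)"
    and K: "\<And>t. t \<in> {0..T} \<Longrightarrow> \<gamma> t \<in> chart_dom c \<Longrightarrow> coord c (\<gamma> t) \<in> cball a R1 \<Longrightarrow> norm (v t) \<le> K"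
    and K0: "K \<ge> 0" and start: "\<gamma> 0 \<in> chart_dom c" "coord c (\<gamma> 0) \<in> cball a R0"
    and small: "R0 + K * T < R1" and t: "t \<in> {0..T}"
  shows "\<gamma> t \<in> chart_dom c \<and> coord c (\<gamma> t) \<in> ball a R1"
proof (rule ccontr)
  assume out: "\<not> ?thesis"
  let ?O = "{q \<in> chart_dom c. coord c q \<in> ball a R1}"
  let ?bad = "{0..T} \<inter> \<gamma> -` (- ?O)"
  have O: "open ?O" by (rule open_coord_preimage[OF ch open_ball])
  have "closed ?bad" using cont O by (intro continuous_closed_preimage) auto
  then have "compact ?bad" using compact_Int_closed[of "{0..T}" ?bad] by (simp add: Int_absorb1)
  moreover have "?bad \<noteq> {}" using t out by auto
  ultimately obtain s where s: "s \<in> ?bad" and first: "\<And>s'. s' \<in> ?bad \<Longrightarrow> s \<le> s'"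
    using compact_attains_inf[of ?bad] by blast
  have "R0 < R1" using small mult_nonneg_nonneg[OF K0, of T] t by simp
  then have "0 \<notin> ?bad" using start by simp
  then have s0: "0 < s" "s \<le> T" using s by (metis IntD1 atLeastAtMost_iff order_less_le)+
  have good: "\<gamma> u \<in> ?O" if "u \<in> {0..<s}" for u
    using first[of u] that s0 by auto
  let ?Q = "param c ` cball a (R0 + K * T)"
  have Qimg: "cball a (R0 + K * T) \<subseteq> chart_img c" using sub small by auto
  have "compact ?Q"
    by (meson Qimg ch compact_cball compact_continuous_image continuous_on_param continuous_on_subset)
  then have "closed ?Q" by (rule compact_imp_closed)
  moreover have "\<gamma> ` {0..<s} \<subseteq> ?Q"
  proof (rule image_subsetI)
    fix u assume u: "u \<in> {0..<s}"
    have "norm (coord c (\<gamma> u) - coord c (\<gamma> 0)) \<le> K * norm (u - 0)"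
    proof (rule differentiable_bound[where S = "{0..<s}" and f = "\<lambda>u. coord c (\<gamma> u)"])
      show "((\<lambda>u. coord c (\<gamma> u)) has_derivative (\<lambda>h. h *\<^sub>R v z)) (at z within {0..<s})"
        if "z \<in> {0..<s}" for z
        using der[of z] good[OF that] that s0
        by (auto simp: has_vector_derivative_def intro: has_derivative_at_withinI)
      show "onorm (\<lambda>h. h *\<^sub>R v z) \<le> K" if "z \<in> {0..<s}" for z
      proof (rule onorm_le)
        have "norm (v z) \<le> K" using K[of z] good[OF that] that s0 by auto
        then show "norm (h *\<^sub>R v z) \<le> K * norm h" for h
          by (simp add: mult.commute[of _ "\<bar>h\<bar>"] mult_left_mono)
      qed
    qed (use u s0 in auto)
    also have "\<dots> \<le> K * T" using u s0 K0 by (intro mult_left_mono) auto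
    finally have "dist a (coord c (\<gamma> u)) \<le> R0 + K * T"
      using start(2) dist_triangle[of a "coord c (\<gamma> u)" "coord c (\<gamma> 0)"]
      by (simp add: dist_norm norm_minus_commute)
    then show "\<gamma> u \<in> ?Q"
      using good[OF u] param_coord[OF ch] by (intro image_eqI[of _ _ "coord c (\<gamma> u)"]) auto
  qed
  moreover have "closure {0..<s} = {0..s}" using s0 by simp
  moreover have "continuous_on {0..s} \<gamma>" using cont s0 by (auto intro: continuous_on_subset)
  ultimately have "\<gamma> ` {0..s} \<subseteq> ?Q" by (metis image_closure_subset)
  then have "\<gamma> s \<in> ?Q" using s0 by auto
  then obtain y where y: "y \<in> cball a (R0 + K * T)" "\<gamma> s = param c y" by blast
  then have "\<gamma> s \<in> ?O"
    using Qimg small by (auto simp: param_in_chart_dom[OF ch] coord_param[OF ch] subset_iff)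
  then show False using s by blast
qed

section \<open>The Hamiltonian vector field on the complexification\<close>

lemma norm_complex_vec_le_sum: "norm (x :: complex^'n) \<le> (\<Sum>i\<in>UNIV. cmod (x $ i))"
  unfolding norm_vec_def by (rule L2_set_le_sum) simp

lemma holo_map_on_continuous_on:
  assumes "holo_map_on S Y"
  shows "continuous_on S Y"
proof -
  have "continuous_on S (\<lambda>x. \<chi> i. Y x $ i)"
    using assms by (intro continuous_on_vec_lambda holo_on_imp_continuous_on) (simp add: holo_map_on_def)
  then show ?thesis by simp
qed

lemma holo_map_on_locally_lipschitz:
  fixes Y :: "complex^'n \<Rightarrow> complex^'k"
  assumes S: "open S" and Y: "holo_map_on S Y" and x: "x \<in> S"
  shows "\<exists>r>0. \<exists>L. \<forall>u\<in>cball x r. \<forall>v\<in>cball x r. norm (Y u - Y v) \<le> L * norm (u - v)"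
proof -
  have "\<exists>r>0. \<exists>L. \<forall>u\<in>cball x r. \<forall>v\<in>cball x r. cmod (Y u $ i - Y v $ i) \<le> L * norm (u - v)" for i
  proof -
    have f: "holo_on S (\<lambda>x. Y x $ i)" using Y by (simp add: holo_map_on_def)
    obtain e M where e: "e > 0" "cball x e \<subseteq> S" and M: "\<And>y. y \<in> cball x e \<Longrightarrow> cmod (Y y $ i) \<le> M"
      using holo_on_bounded_near[OF f S x] by metis
    have "cmod (Y u $ i - Y v $ i) \<le> M / (e / 2) * norm (u - v)"
      if "u \<in> cball x (e / 2)" "v \<in> cball x (e / 2)" for u v
      by (rule cauchy_lipschitz[OF f, where p = x and s = "e / 2"]) (use that e M in auto)
    then show ?thesis using e(1) by (metis half_gt_zero)
  qed
  then obtain r L where r: "\<And>i. r i > 0"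
    and L: "\<And>i u v. u \<in> cball x (r i) \<Longrightarrow> v \<in> cball x (r i) \<Longrightarrow>
      cmod (Y u $ i - Y v $ i) \<le> L i * norm (u - v)"
    by metis
  define d where "d = Min (range r)"
  have "d > 0" using r by (simp add: d_def)
  moreover have d: "cball x d \<subseteq> cball x (r i)" for i
    by (intro subset_cball) (simp add: d_def)
  have "norm (Y u - Y v) \<le> (\<Sum>i\<in>UNIV. L i) * norm (u - v)" if "u \<in> cball x d" "v \<in> cball x d" for u v
  proof -
    have "norm (Y u - Y v) \<le> (\<Sum>i\<in>UNIV. cmod (Y u $ i - Y v $ i))"
      using norm_complex_vec_le_sum[of "Y u - Y v"] by simp
    also have "\<dots> \<le> (\<Sum>i\<in>UNIV. L i * norm (u - v))"
      using that d by (intro sum_mono L) blast+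
    finally show ?thesis by (simp add: sum_distrib_right)
  qed
  ultimately show ?thesis by blast
qed

definition complex_symplectic :: "(complex^'n \<Rightarrow> complex^'n \<Rightarrow> complex) \<Rightarrow> bool" where
  "complex_symplectic B \<longleftrightarrow> bilinear B \<and> (\<forall>u. B u u = 0) \<and>
     (\<forall>a u v. B (a *s u) v = a * B u v) \<and> (\<forall>u. (\<forall>v. B u v = 0) \<longrightarrow> u = 0)"

definition complex_linear_functional :: "(complex^'n \<Rightarrow> complex) \<Rightarrow> bool" where
  "complex_linear_functional l \<longleftrightarrow> linear l \<and> (\<forall>a v. l (a *s v) = a * l v)"

lemma complex_linear_functional_basis:
  assumes "complex_linear_functional l"
  shows "l v = (\<Sum>i\<in>UNIV. v $ i * l (axis i 1))"
proof -
  have "l v = l (\<Sum>i\<in>UNIV. v $ i *s axis i 1)" by (simp add: basis_expansion)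
  then show ?thesis using assms by (simp add: complex_linear_functional_def linear_sum)
qed

lemma complex_symplectic_antisym:
  assumes "complex_symplectic B"
  shows "B u v = - B v u"
proof -
  have b: "bilinear B" and alt: "\<And>u. B u u = 0" using assms by (auto simp: complex_symplectic_def)
  have "B (u + v) (u + v) = (B u u + B u v) + (B v u + B v v)"
    by (simp only: bilinear_ladd[OF b] bilinear_radd[OF b] add_ac)
  then have "B u v + B v u = 0" by (simp add: alt)
  then show ?thesis by (simp add: eq_neg_iff_add_eq_0)
qed

lemma complex_symplectic_left:
  assumes "complex_symplectic B"
  shows "complex_linear_functional (\<lambda>u. B u v)"
  using assms by (auto simp: complex_symplectic_def complex_linear_functional_def bilinear_def)

lemma complex_symplectic_right:
  assumes "complex_symplectic B"
  shows "complex_linear_functional (B u)"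
proof -
  have "B u (a *s v) = a * B u v" for a v
    using assms complex_symplectic_antisym[OF assms, of u] by (simp add: complex_symplectic_def)
  then show ?thesis
    using assms by (auto simp: complex_symplectic_def complex_linear_functional_def bilinear_def)
qed

text \<open>The index order makes \<open>form_matrix B *v u\<close> the vector of the values of \<open>B u\<close> on the basis.\<close>

definition form_matrix :: "(complex^'n \<Rightarrow> complex^'n \<Rightarrow> complex) \<Rightarrow> complex^'n^'n" where
  "form_matrix B = (\<chi> i j. B (axis j 1) (axis i 1))"

lemma form_matrix_mult:
  assumes "complex_symplectic B"
  shows "(form_matrix B *v u) $ i = B u (axis i 1)"
  unfolding complex_linear_functional_basis[OF complex_symplectic_left[OF assms], of u]
  by (simp add: form_matrix_def matrix_vector_mult_def mult.commute)

lemma contraction_eq_iff: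
  assumes B: "complex_symplectic B" and l: "complex_linear_functional l"
  shows "(\<forall>v. B u v = l v) \<longleftrightarrow> form_matrix B *v u = (\<chi> i. l (axis i 1))"
proof
  assume "\<forall>v. B u v = l v"
  then show "form_matrix B *v u = (\<chi> i. l (axis i 1))"
    by (simp add: vec_eq_iff form_matrix_mult[OF B])
next
  assume "form_matrix B *v u = (\<chi> i. l (axis i 1))"
  then have basis: "B u (axis i 1) = l (axis i 1)" for i
    by (metis form_matrix_mult[OF B] vec_lambda_beta)
  show "\<forall>v. B u v = l v"
  proof
    fix v
    have "B u v = (\<Sum>i\<in>UNIV. v $ i * B u (axis i 1))"
      by (rule complex_linear_functional_basis[OF complex_symplectic_right[OF B]])
    also have "\<dots> = (\<Sum>i\<in>UNIV. v $ i * l (axis i 1))" by (simp only: basis)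
    also have "\<dots> = l v" by (rule complex_linear_functional_basis[OF l, symmetric])
    finally show "B u v = l v" .
  qed
qed

lemma form_matrix_det_nonzero:
  assumes B: "complex_symplectic B"
  shows "det (form_matrix B) \<noteq> 0"
proof -
  have "u = 0" if "form_matrix B *v u = 0" for u
  proof -
    have "complex_linear_functional (\<lambda>v. 0)" by (simp add: complex_linear_functional_def linear_zero)
    from contraction_eq_iff[OF B this, of u] have "\<forall>v. B u v = 0"
      using that by (simp add: vec_eq_iff)
    then show ?thesis using B by (simp add: complex_symplectic_def)
  qed
  then have "invertible (form_matrix B)"
    by (simp add: invertible_left_inverse matrix_left_invertible_ker)
  then show ?thesis by (simp add: invertible_det_nz)
qed

definition cramer_solution :: "complex^'n^'n \<Rightarrow> complex^'n \<Rightarrow> complex^'n" where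
  "cramer_solution A b = (\<chi> k. det (\<chi> i j. if j = k then b $ i else A $ i $ j) / det A)"

lemma contraction_eq_cramer:
  assumes "complex_symplectic B" "complex_linear_functional l"
  shows "(\<forall>v. B u v = l v) \<longleftrightarrow> u = cramer_solution (form_matrix B) (\<chi> i. l (axis i 1))"
  unfolding contraction_eq_iff[OF assms] cramer_solution_def
  using cramer[OF form_matrix_det_nonzero[OF assms(1)]] by auto

text \<open>The real part at \<open>\<i> *s v\<close> is minus the imaginary part at \<open>v\<close>.\<close>

lemma complex_functional_eq_iff_Re:
  assumes "complex_linear_functional l" "complex_linear_functional l'"
  shows "(\<forall>v. Re (l v) = Re (l' v)) \<longleftrightarrow> (\<forall>v. l v = l' v)"
proof
  assume re: "\<forall>v. Re (l v) = Re (l' v)"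
  show "\<forall>v. l v = l' v"
  proof
    fix v
    have "Re (l (\<i> *s v)) = Re (l' (\<i> *s v))" using re by blast
    then have "Im (l v) = Im (l' v)" using assms by (simp add: complex_linear_functional_def)
    then show "l v = l' v" using re by (simp add: complex_eq_iff)
  qed
qed simp

text \<open>A map between coordinate vectors, so that the theory of holomorphic vector fields on open sets
  applies; it will turn out to be the holomorphic Hamiltonian vector field of \<open>P\<close> itself.\<close>

definition ham_coords :: "('c, complex^'k, complex) form2 \<Rightarrow> ('c \<Rightarrow> complex) \<Rightarrow> ('c, complex^'k) chart
    \<Rightarrow> complex^'k \<Rightarrow> complex^'k" where
  "ham_coords \<omega>C P C x = ham_vf (re_form \<omega>C) (\<lambda>q. Re (P q)) C (param C x)"

lemma holomorphic_symplectic_at: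
  assumes "holomorphic_symplectic JC \<omega>C" "C \<in> JC" "q \<in> chart_dom C"
  shows "complex_symplectic (\<omega>C C q)"
  using assms unfolding holomorphic_symplectic_def complex_symplectic_def two_form_def by blast

lemma complex_linear_derivative:
  assumes "holo_on S f" "x \<in> S"
  shows "complex_linear_functional (frechet_derivative f (at x))"
  unfolding complex_linear_functional_def
  using holo_on_derivative_scale[OF assms] has_derivative_linear[OF holo_on_has_derivative[OF assms]]
  by blast

text \<open>The defining condition of the real vector field is the real part of \<open>\<omega>\<^sub>C(u, \<cdot>) = dP\<close>, hence
  equivalent to it; Cramer's rule makes the solution visibly holomorphic.\<close>

lemma ham_coords_cramer:
  assumes J: "complex_structure JC" and \<omega>: "holomorphic_symplectic JC \<omega>C"
    and P: "regular_fun holo_on JC P" and C: "C \<in> JC" and x: "x \<in> chart_img C"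
  shows "ham_coords \<omega>C P C x = cramer_solution (form_matrix (\<omega>C C (param C x)))
           (\<chi> i. frechet_derivative (P \<circ> param C) (at x) (axis i 1))"
proof -
  note ch = mfd_structure_is_chart[OF J C]
  have B: "complex_symplectic (\<omega>C C (param C x))"
    using holomorphic_symplectic_at[OF \<omega> C] param_in_chart_dom[OF ch x] by blast
  have PC: "holo_on (chart_img C) (P \<circ> param C)" using P C by (simp add: regular_fun_def)
  note l = complex_linear_derivative[OF PC x]
  have "dfun C (\<lambda>q. Re (P q)) (param C x) = (\<lambda>v. Re (frechet_derivative (P \<circ> param C) (at x) v))"
  proof -
    have "((\<lambda>y. Re ((P \<circ> param C) y)) has_derivative
        (\<lambda>v. Re (frechet_derivative (P \<circ> param C) (at x) v))) (at x)"
      using bounded_linear.has_derivative[OF bounded_linear_Re holo_on_has_derivative[OF PC x]] .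
    from frechet_derivative_at[OF this] show ?thesis
      by (simp add: dfun_def coord_param[OF ch x] comp_def)
  qed
  then have "(\<forall>v. re_form \<omega>C C (param C x) u v = dfun C (\<lambda>q. Re (P q)) (param C x) v) \<longleftrightarrow>
      u = cramer_solution (form_matrix (\<omega>C C (param C x)))
           (\<chi> i. frechet_derivative (P \<circ> param C) (at x) (axis i 1))" for u
    using complex_functional_eq_iff_Re[OF complex_symplectic_right[OF B] l, of u]
      contraction_eq_cramer[OF B l, of u] by (simp add: re_form_def)
  then show ?thesis by (simp add: ham_coords_def ham_vf_def)
qed

lemma ham_coords_unique:
  assumes J: "complex_structure JC" and \<omega>: "holomorphic_symplectic JC \<omega>C"
    and P: "regular_fun holo_on JC P" and C: "C \<in> JC" and x: "x \<in> chart_img C"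
    and u: "\<And>v. \<omega>C C (param C x) u v = frechet_derivative (P \<circ> param C) (at x) v"
  shows "ham_coords \<omega>C P C x = u"
proof -
  note ch = mfd_structure_is_chart[OF J C]
  have B: "complex_symplectic (\<omega>C C (param C x))"
    using holomorphic_symplectic_at[OF \<omega> C] param_in_chart_dom[OF ch x] by blast
  have PC: "holo_on (chart_img C) (P \<circ> param C)" using P C by (simp add: regular_fun_def)
  show ?thesis
    unfolding ham_coords_cramer[OF J \<omega> P C x]
    using contraction_eq_cramer[OF B complex_linear_derivative[OF PC x], of u] u by simp
qed

lemma holo_map_on_ham_coords:
  assumes J: "complex_structure JC" and \<omega>: "holomorphic_symplectic JC \<omega>C"
    and P: "regular_fun holo_on JC P" and C: "C \<in> JC"
  shows "holo_map_on (chart_img C) (ham_coords \<omega>C P C)"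
  unfolding holo_map_on_def
proof
  fix k
  note ch = mfd_structure_is_chart[OF J C]
  have op: "open (chart_img C)" using ch by (simp add: is_chart_def)
  have PC: "holo_on (chart_img C) (P \<circ> param C)" using P C by (simp add: regular_fun_def)
  have entries: "holo_on (chart_img C) (\<lambda>x. \<omega>C C (param C x) u v)" for u v
    using \<omega> C by (simp add: holomorphic_symplectic_def regular_form_def)
  have nz: "det (form_matrix (\<omega>C C (param C x))) \<noteq> 0" if "x \<in> chart_img C" for x
    using form_matrix_det_nonzero holomorphic_symplectic_at[OF \<omega> C] param_in_chart_dom[OF ch that] by blast
  have "holo_on (chart_img C) (\<lambda>x. det (\<chi> i j. if j = k
        then (\<chi> i. frechet_derivative (P \<circ> param C) (at x) (axis i 1)) $ i
        else form_matrix (\<omega>C C (param C x)) $ i $ j) *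
      inverse (det (form_matrix (\<omega>C C (param C x)))))"
  proof (intro holo_on_mult holo_on_inverse holo_on_det nz)
    fix i j
    show "holo_on (chart_img C) (\<lambda>x. (\<chi> i j. if j = k
        then (\<chi> i. frechet_derivative (P \<circ> param C) (at x) (axis i 1)) $ i
        else form_matrix (\<omega>C C (param C x)) $ i $ j) $ i $ j)"
      by (cases "j = k") (simp_all add: form_matrix_def entries holo_on_frechet_derivative[OF op PC])
    show "holo_on (chart_img C) (\<lambda>x. form_matrix (\<omega>C C (param C x)) $ i $ j)"
      by (simp add: form_matrix_def entries)
  qed auto
  then show "holo_on (chart_img C) (\<lambda>x. ham_coords \<omega>C P C x $ k)"
    by (rule holo_on_transform_open[OF _ op])
      (simp add: ham_coords_cramer[OF J \<omega> P C] cramer_solution_def divide_inverse)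
qed

lemma locally_lipschitz_ham:
  assumes J: "complex_structure JC" and \<omega>: "holomorphic_symplectic JC \<omega>C"
    and P: "regular_fun holo_on JC P"
  shows "locally_lipschitz_vf JC (\<lambda>C q. - ham_vf (re_form \<omega>C) (\<lambda>q. Re (P q)) C q)"
  unfolding locally_lipschitz_vf_def
proof (intro ballI)
  fix C p assume C: "C \<in> JC" and p: "p \<in> chart_dom C"
  have "open (chart_img C)" using mfd_structure_is_chart[OF J C] by (simp add: is_chart_def)
  from holo_map_on_locally_lipschitz[OF this holo_map_on_ham_coords[OF J \<omega> P C] imageI[OF p]]
  show "\<exists>r>0. \<exists>L. \<forall>u\<in>cball (coord C p) r. \<forall>v\<in>cball (coord C p) r.
      norm (- ham_vf (re_form \<omega>C) (\<lambda>q. Re (P q)) C (param C u) -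
            - ham_vf (re_form \<omega>C) (\<lambda>q. Re (P q)) C (param C v)) \<le> L * norm (u - v)"
    by (simp add: ham_coords_def norm_minus_commute)
qed

section \<open>Restriction to the real locus\<close>

text \<open>The coordinate expression of \<open>\<iota>\<close>, a real linear map.\<close>

definition conj_graph :: "complex^'n \<Rightarrow> complex^('n + 'n)" where
  "conj_graph z = (\<chi> i. case i of Inl j \<Rightarrow> z $ j | Inr k \<Rightarrow> cnj (z $ k))"

lemma zC_conj_graph [simp]: "zC (conj_graph z) = z"
  by (simp add: conj_graph_def zC_def vec_eq_iff)

lemma wC_conj_graph [simp]: "wC (conj_graph z) = cnj_vec z"
  by (simp add: conj_graph_def wC_def cnj_vec_def vec_eq_iff)

lemma vec_sum_eqI:
  assumes "zC x = zC y" "wC x = wC y"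
  shows "x = y"
  unfolding vec_eq_iff
proof
  fix i show "x $ i = y $ i"
    using assms by (cases i) (simp_all add: zC_def wC_def vec_eq_iff)
qed

lemma bounded_linear_conj_graph: "bounded_linear conj_graph"
proof -
  have "linear conj_graph"
  proof (rule linearI)
    show "conj_graph (x + y) = conj_graph x + conj_graph y" for x y :: "complex^'n"
      by (rule vec_sum_eqI) (auto simp: conj_graph_def zC_def wC_def vec_eq_iff)
    show "conj_graph (r *\<^sub>R x) = r *\<^sub>R conj_graph x" for r and x :: "complex^'n"
      by (rule vec_sum_eqI) (auto simp: conj_graph_def zC_def wC_def vec_eq_iff)
  qed
  then show ?thesis by (rule linear_conv_bounded_linear[THEN iffD1])
qed

text \<open>The real subspace of the vectors \<open>(z, cnj z)\<close> spans the whole space over the complex numbers.\<close>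

lemma complex_functional_eqI_on_conj_graph:
  fixes l :: "complex^('n::finite + 'n) \<Rightarrow> complex"
  assumes l: "complex_linear_functional l" and l': "complex_linear_functional l'"
    and eq: "\<And>v. l (conj_graph v) = l' (conj_graph v)"
  shows "l w = l' w"
proof -
  define a where "a = (1 / 2) *s (zC w + cnj_vec (wC w))"
  define b where "b = (1 / (2 * \<i>)) *s (zC w - cnj_vec (wC w))"
  have w: "w = conj_graph a + \<i> *s conj_graph b"
  proof (rule vec_sum_eqI)
    show "zC w = zC (conj_graph a + \<i> *s conj_graph b)"
      by (simp add: a_def b_def zC_def wC_def cnj_vec_def conj_graph_def vec_eq_iff field_simps)
    show "wC w = wC (conj_graph a + \<i> *s conj_graph b)"
      by (simp add: a_def b_def zC_def wC_def cnj_vec_def conj_graph_def vec_eq_iff field_simps)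
  qed
  show ?thesis
    using l l' eq unfolding w complex_linear_functional_def by (simp add: linear_add)
qed

lemma complexified_chart_iota:
  assumes "complexified_chart \<omega> \<omega>C \<iota> \<pi>\<^sub>0 c C" "p \<in> chart_dom c"
  shows "\<iota> p \<in> chart_dom C" "coord C (\<iota> p) = conj_graph (coord c p)"
proof -
  show "\<iota> p \<in> chart_dom C" using assms unfolding complexified_chart_def by blast
  show "coord C (\<iota> p) = conj_graph (coord c p)"
    using assms unfolding complexified_chart_def by (intro vec_sum_eqI) auto
qed

lemma complexified_chart_form:
  assumes "complexified_chart \<omega> \<omega>C \<iota> \<pi>\<^sub>0 c C" "p \<in> chart_dom c"
  shows "\<omega>C C (\<iota> p) (conj_graph u) (conj_graph v) = complex_of_real (\<omega> c p u v)"
proof -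
  note \<iota> = complexified_chart_iota[OF assms]
  obtain g gC where g: "\<forall>p\<in>chart_dom c. \<forall>u v. complex_of_real (\<omega> c p u v) =
           (\<Sum>j\<in>UNIV. \<Sum>k\<in>UNIV. \<i> * g p j k * (u $ j * cnj (v $ k) - v $ j * cnj (u $ k)))"
    and gC: "\<forall>q\<in>chart_dom C. \<forall>u v. \<omega>C C q u v =
           (\<Sum>j\<in>UNIV. \<Sum>k\<in>UNIV. \<i> * gC q j k * (zC u $ j * wC v $ k - zC v $ j * wC u $ k))"
    and eq: "\<forall>p\<in>chart_dom c. \<forall>j k. gC (\<iota> p) j k = g p j k"
    using assms(1) unfolding complexified_chart_def by blast
  show ?thesis
    using g gC eq \<iota>(1) assms(2) by (simp add: cnj_vec_def)
qed

lemma derivative_on_real_locus: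
  assumes cc: "complexified_chart \<omega> \<omega>C \<iota> \<pi>\<^sub>0 c C" and ch: "is_chart c" and p: "p \<in> chart_dom c"
    and F: "holo_on (chart_img C) F"
    and f: "\<And>m. m \<in> chart_dom c \<Longrightarrow> f m = F (coord C (\<iota> m))"
  shows "((f \<circ> param c) has_derivative (\<lambda>v. frechet_derivative F (at (coord C (\<iota> p))) (conj_graph v)))
           (at (coord c p))"
proof (rule has_derivative_transform_within_open)
  have "coord C (\<iota> p) \<in> chart_img C" using complexified_chart_iota[OF cc p] by blast
  from holo_on_has_derivative[OF F this]
  have "(F has_derivative frechet_derivative F (at (coord C (\<iota> p)))) (at (conj_graph (coord c p)))"
    by (simp add: complexified_chart_iota[OF cc p])
  from has_derivative_compose[OF bounded_linear_imp_has_derivative[OF bounded_linear_conj_graph] this]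
  show "((\<lambda>x. F (conj_graph x)) has_derivative
      (\<lambda>v. frechet_derivative F (at (coord C (\<iota> p))) (conj_graph v))) (at (coord c p))" .
  show "open (chart_img c)" using ch by (simp add: is_chart_def)
  show "coord c p \<in> chart_img c" using p by simp
  show "F (conj_graph x) = (f \<circ> param c) x" if "x \<in> chart_img c" for x
    using f[of "param c x"] complexified_chart_iota[OF cc, of "param c x"] param_in_chart_dom[OF ch that]
      coord_param[OF ch that] by simp
qed

text \<open>The description in the definition of the Hamiltonian vector field is met by exactly one vector:
  \<open>u \<mapsto> \<omega>(u, \<cdot>)\<close> is injective, because \<open>\<omega>(u, \<i> u) > 0\<close>, and therefore onto the dual space, which
  the inner product identifies with the space itself (the map \<open>T\<close> of the proof).\<close>

lemma ham_vf_contraction: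
  fixes \<omega> :: "('m, complex^'n, real) form2"
  assumes bil: "bilinear (\<omega> c p)" and pos: "\<And>u. u \<noteq> 0 \<Longrightarrow> \<omega> c p u (\<i> *s u) > 0"
    and lin: "linear (dfun c f p)"
  shows "\<omega> c p (ham_vf \<omega> f c p) v = dfun c f p v"
proof -
  let ?B = "\<omega> c p"
  have linl: "linear (\<lambda>u. ?B u v)" and linr: "linear (?B u)" for u v
    using bil by (auto simp: bilinear_def)
  define T where "T u = (\<Sum>b\<in>Basis. ?B u b *\<^sub>R b)" for u
  have T: "T u \<bullet> b = ?B u b" if "b \<in> Basis" for u b
    using that by (simp add: T_def)
  have eqI: "\<forall>v. ?B u v = l v" if "linear l" "\<And>b. b \<in> Basis \<Longrightarrow> ?B u b = l b" for u l
    using linear_eq_on_span[OF linr that(1), where B = Basis] that(2) by auto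
  have linT: "linear T"
    unfolding T_def by (intro linear_compose_sum ballI)
      (auto intro!: linearI simp: linear_add[OF linl] linear_cmul[OF linl] algebra_simps)
  moreover have "inj T"
  proof (subst linear_injective_0[OF linT], intro allI impI)
    fix u assume "T u = 0"
    then have "?B u b = 0" if "b \<in> Basis" for b using T[OF that, of u] by simp
    then have "?B u (\<i> *s u) = 0" using eqI[of "\<lambda>v. 0"] by (simp add: linear_zero)
    then show "u = 0" using pos by force
  qed
  ultimately have surj: "surj T" by (simp add: linear_injective_imp_surjective)
  obtain u where u: "T u = (\<Sum>b\<in>Basis. dfun c f p b *\<^sub>R b)" using surj by (metis surjD)
  have uB: "\<forall>v. ?B u v = dfun c f p v"
  proof (rule eqI[OF lin])
    fix b :: "complex^'n" assume b: "b \<in> Basis"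
    show "?B u b = dfun c f p b" using T[OF b, of u] b by (simp add: u)
  qed
  have "\<exists>!u. \<forall>v. ?B u v = dfun c f p v"
  proof (rule ex1I)
    show "\<forall>v. ?B u v = dfun c f p v" by (fact uB)
  next
    fix u' assume "\<forall>v. ?B u' v = dfun c f p v"
    then have "T u' = T u" using uB by (simp add: T_def)
    then show "u' = u" using \<open>inj T\<close> by (simp add: inj_eq)
  qed
  from theI'[OF this] show ?thesis by (simp add: ham_vf_def)
qed

text \<open>Since \<open>\<omega>\<^sub>C\<close> restricts to \<open>\<omega>\<close>, both vectors have the same contraction with \<open>\<omega>\<^sub>C\<close> on the tangent
  vectors of \<open>M\<close>, and these span the tangent space of the complexification.\<close>

lemma ham_coords_on_real_locus:
  fixes \<omega> :: "('m::topological_space, complex^'n, real) form2"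
  assumes J: "complex_structure JC" and \<omega>C: "holomorphic_symplectic JC \<omega>C"
    and P: "regular_fun holo_on JC P" and C: "C \<in> JC"
    and K: "kaehler S J \<omega>" and c: "c \<in> J"
    and cc: "complexified_chart \<omega> \<omega>C \<iota> \<pi>\<^sub>0 c C"
    and P\<iota>: "\<And>m. P (\<iota> m) = \<tau> * complex_of_real (h m)" and p: "p \<in> chart_dom c"
  shows "ham_coords \<omega>C P C (coord C (\<iota> p)) = \<tau> *s conj_graph (ham_vf \<omega> h c p)"
proof (rule ham_coords_unique[OF J \<omega>C P C])
  note chC = mfd_structure_is_chart[OF J C]
  have ch: "is_chart c" using K c mfd_structure_is_chart unfolding kaehler_def by blast
  note \<iota> = complexified_chart_iota[OF cc p]
  let ?x = "coord C (\<iota> p)" and ?X = "ham_vf \<omega> h c p"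
  let ?D = "frechet_derivative (P \<circ> param C) (at ?x)"
  show x: "?x \<in> chart_img C" using \<iota>(1) by (rule imageI)
  have PC: "holo_on (chart_img C) (P \<circ> param C)" using P C by (simp add: regular_fun_def)
  have px: "param C ?x = \<iota> p" by (rule param_coord[OF chC \<iota>(1)])
  have B: "complex_symplectic (\<omega>C C (\<iota> p))" by (rule holomorphic_symplectic_at[OF \<omega>C C \<iota>(1)])
  have bil: "bilinear (\<omega> c p)" and pos: "\<And>u. u \<noteq> 0 \<Longrightarrow> \<omega> c p u (\<i> *s u) > 0"
    using K c p unfolding kaehler_def two_form_def by blast+
  have D\<tau>: "(((\<lambda>m. \<tau> * complex_of_real (h m)) \<circ> param c) has_derivative (\<lambda>v. ?D (conj_graph v))) (at (coord c p))"
    by (rule derivative_on_real_locus[OF cc ch p PC])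
      (simp add: P\<iota>[symmetric] param_coord[OF chC complexified_chart_iota(1)[OF cc]])
  \<comment> \<open>For \<open>\<tau> = 0\<close> the function \<open>P\<close> vanishes on \<open>M\<close>; otherwise \<open>h = P \<circ> \<iota> / \<tau>\<close> inherits its derivative.\<close>
  have contr: "\<tau> * complex_of_real (\<omega> c p ?X v) = ?D (conj_graph v)" for v
  proof (cases "\<tau> = 0")
    case True
    then have "((\<lambda>m. 0) has_derivative (\<lambda>v. ?D (conj_graph v))) (at (coord c p))"
      using D\<tau> by (simp add: comp_def)
    then have "(\<lambda>v. ?D (conj_graph v)) = (\<lambda>v. 0)"
      using has_derivative_unique has_derivative_const by blast
    then show ?thesis using True by (metis mult_zero_left)
  next
    case False
    have "((\<lambda>y. Re (1 / \<tau> * (\<tau> * complex_of_real (h (param c y))))) has_derivative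
        (\<lambda>v. Re (1 / \<tau> * ?D (conj_graph v)))) (at (coord c p))"
      using D\<tau> unfolding comp_def
      by (intro bounded_linear.has_derivative[OF bounded_linear_Re] has_derivative_mult_right)
    then have hder: "((h \<circ> param c) has_derivative (\<lambda>v. Re (1 / \<tau> * ?D (conj_graph v)))) (at (coord c p))"
      using False by (simp add: comp_def)
    then have hd: "(h \<circ> param c has_derivative dfun c h p) (at (coord c p))"
      unfolding dfun_def using frechet_derivative_at by fastforce
    have "((\<lambda>y. \<tau> * complex_of_real ((h \<circ> param c) y)) has_derivative
        (\<lambda>v. \<tau> * complex_of_real (dfun c h p v))) (at (coord c p))"
      by (intro has_derivative_mult_right has_derivative_of_real hd)
    then have "(\<lambda>v. \<tau> * complex_of_real (dfun c h p v)) = (\<lambda>v. ?D (conj_graph v))"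
      using D\<tau> unfolding comp_def by (rule has_derivative_unique)
    moreover have "\<omega> c p ?X v = dfun c h p v"
      by (rule ham_vf_contraction) (use bil pos has_derivative_linear[OF hd] in auto)
    ultimately show ?thesis by (metis)
  qed
  show "\<omega>C C (param C ?x) (\<tau> *s conj_graph ?X) w = ?D w" for w
    unfolding px
  proof (rule complex_functional_eqI_on_conj_graph[OF complex_symplectic_right[OF B] complex_linear_derivative[OF PC x]])
    show "\<omega>C C (\<iota> p) (\<tau> *s conj_graph ?X) (conj_graph v) = ?D (conj_graph v)" for v
      using B contr[of v] complexified_chart_form[OF cc p, of ?X v] by (simp add: complex_symplectic_def)
  qed
qed

text \<open>Each step multiplies by \<open>\<tau>\<close>, because along \<open>M\<close> the holomorphic vector field is \<open>\<tau>\<close> times a vector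
  field tangent to \<open>M\<close>, and the functions are holomorphic.  To differentiate on \<open>M\<close>, the \<open>k\<close>-th function
  has to be divided by \<open>\<tau>\<^sup>k\<close>; if \<open>\<tau> = 0\<close>, then the holomorphic vector field vanishes on \<open>M\<close> and so do both sides for \<open>k > 0\<close>.\<close>

lemma deriv_along_iterate_on_real_locus:
  fixes \<omega> :: "('m::topological_space, complex^'n, real) form2"
  assumes J: "complex_structure JC" and \<omega>C: "holomorphic_symplectic JC \<omega>C"
    and P: "regular_fun holo_on JC P" and C: "C \<in> JC"
    and K: "kaehler S J \<omega>" and c: "c \<in> J"
    and cc: "complexified_chart \<omega> \<omega>C \<iota> \<pi>\<^sub>0 c C"
    and P\<iota>: "\<And>m. P (\<iota> m) = \<tau> * complex_of_real (h m)" 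
    and F: "holo_on (chart_img C) F"
    and f: "\<And>m. m \<in> chart_dom c \<Longrightarrow> f m = F (coord C (\<iota> m))"
    and p: "p \<in> chart_dom c"
  shows "(deriv_along (ham_coords \<omega>C P C) ^^ k) F (coord C (\<iota> p)) = \<tau> ^ k * (lie (ham_vf \<omega> h) c ^^ k) f p"
  using p
proof (induction k arbitrary: p)
  case 0
  then show ?case using f by simp
next
  case (Suc k)
  let ?Y = "ham_coords \<omega>C P C"
  let ?F = "(deriv_along ?Y ^^ k) F" and ?f = "(lie (ham_vf \<omega> h) c ^^ k) f"
  have ch: "is_chart c" using K c mfd_structure_is_chart unfolding kaehler_def by blast
  have op: "open (chart_img C)" using mfd_structure_is_chart[OF J C] by (simp add: is_chart_def)
  have holo: "holo_on (chart_img C) ?F"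
    by (rule holo_on_deriv_along_iterate[OF op F holo_map_on_ham_coords[OF J \<omega>C P C]])
  let ?x = "coord C (\<iota> p)"
  have x: "?x \<in> chart_img C" using complexified_chart_iota(1)[OF cc Suc.prems] by (rule imageI)
  have step: "deriv_along ?Y ?F ?x = \<tau> * frechet_derivative ?F (at ?x) (conj_graph (ham_vf \<omega> h c p))"
    by (simp add: deriv_along_def ham_coords_on_real_locus[OF J \<omega>C P C K c cc P\<iota> Suc.prems]
        holo_on_derivative_scale[OF holo x])
  show ?case
  proof (cases "\<tau> = 0")
    case True
    then show ?thesis using step by simp
  next
    case False
    have scaled: "holo_on (chart_img C) (\<lambda>y. 1 / \<tau> ^ k * ?F y)"
      by (intro holo_on_mult holo_on_const holo)
    have "((?f \<circ> param c) has_derivative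
        (\<lambda>v. frechet_derivative (\<lambda>y. 1 / \<tau> ^ k * ?F y) (at ?x) (conj_graph v))) (at (coord c p))"
      by (rule derivative_on_real_locus[OF cc ch Suc.prems scaled]) (use Suc.IH False in simp)
    moreover have "frechet_derivative (\<lambda>y. 1 / \<tau> ^ k * ?F y) (at ?x) = (\<lambda>v. 1 / \<tau> ^ k * frechet_derivative ?F (at ?x) v)"
      by (rule frechet_derivative_at[symmetric], rule has_derivative_mult_right, rule holo_on_has_derivative[OF holo x])
    ultimately have "dfun c ?f p = (\<lambda>v. 1 / \<tau> ^ k * frechet_derivative ?F (at ?x) (conj_graph v))"
      unfolding dfun_def by (metis frechet_derivative_at)
    then have "lie (ham_vf \<omega> h) c ?f p = 1 / \<tau> ^ k * frechet_derivative ?F (at ?x) (conj_graph (ham_vf \<omega> h c p))"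
      by (simp add: lie_def)
    then show ?thesis using step False by simp
  qed
qed

section \<open>The flow projects to the exponential\<close>

text \<open>Along \<open>s \<mapsto> \<eta> (- s) (\<iota> p)\<close> the coordinates \<open>z\<^sub>C\<close> are the sum of their Taylor series, whose
  coefficients on \<open>M\<close> are those of the exponential series of \<open>X\<^sub>h\<close>.  The time \<open>\<delta>\<close> depends only on a bound for the
  vector field near \<open>\<iota> p\<^sub>0\<close>, hence serves for all \<open>p\<close> near \<open>p\<^sub>0\<close>.\<close>

lemma flow_projects_to_exp_near:
  fixes \<omega> :: "('m::t2_space, complex^'n, real) form2" and \<omega>C :: "('c::t2_space, complex^('n + 'n), complex) form2"
  assumes K: "kaehler S J \<omega>" and cx: "complexification J \<omega> JC \<omega>C \<iota> \<pi>\<^sub>0"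
    and P: "analytic_continuation JC \<iota> (\<lambda>p. \<tau> * complex_of_real (h p)) P"
    and W: "range \<iota> \<subseteq> W"
    and flow: "local_flow JC (\<lambda>c q. - ham_vf (re_form \<omega>C) (\<lambda>x. Re (P x)) c q) W \<epsilon> \<eta>"
    and \<rho>: "\<rho> > 0" and exp: "acts_as_exp J (ham_vf \<omega> h) \<rho> \<phi>"
  shows "\<exists>V \<delta>. open V \<and> p\<^sub>0 \<in> V \<and> \<delta> > 0 \<and>
    (\<forall>p\<in>V. \<forall>t. \<bar>t\<bar> < \<delta> \<longrightarrow> \<eta> t (\<iota> p) \<in> W \<and> \<pi>\<^sub>0 (\<eta> (- t) (\<iota> p)) = \<phi> (of_real t * \<tau>) p)"
proof -
  have JC: "complex_structure JC" and \<omega>C: "holomorphic_symplectic JC \<omega>C"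
    using cx by (auto simp: complexification_def)
  have Pholo: "regular_fun holo_on JC P" and P\<iota>: "\<And>m. P (\<iota> m) = \<tau> * complex_of_real (h m)"
    using P by (auto simp: analytic_continuation_def fun_eq_iff)
  obtain c V\<^sub>0 where c: "c \<in> J" and V\<^sub>0: "open V\<^sub>0" "p\<^sub>0 \<in> V\<^sub>0" "V\<^sub>0 \<subseteq> chart_dom c"
    and \<phi>: "\<forall>\<sigma>. cmod \<sigma> < \<rho> \<longrightarrow> \<phi> \<sigma> ` V\<^sub>0 \<subseteq> chart_dom c \<and>
      (\<forall>q\<in>V\<^sub>0. \<forall>i. (\<lambda>k. \<sigma> ^ k / fact k * (lie (ham_vf \<omega> h) c ^^ k) (\<lambda>m. coord c m $ i) q)
         sums (coord c (\<phi> \<sigma> q) $ i))"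
    using exp[unfolded acts_as_exp_def, rule_format, of p\<^sub>0] by (elim bexE exE conjE) (rule that)
  have \<phi>dom: "\<phi> \<sigma> q \<in> chart_dom c" if "cmod \<sigma> < \<rho>" "q \<in> V\<^sub>0" for \<sigma> q
    using \<phi> that by blast
  have \<phi>exp: "(\<lambda>k. \<sigma> ^ k / fact k * (lie (ham_vf \<omega> h) c ^^ k) (\<lambda>m. coord c m $ i) q)
      sums (coord c (\<phi> \<sigma> q) $ i)" if "cmod \<sigma> < \<rho>" "q \<in> V\<^sub>0" for \<sigma> q i
    using \<phi> that by blast
  obtain C where C: "C \<in> JC" and cc: "complexified_chart \<omega> \<omega>C \<iota> \<pi>\<^sub>0 c C"
    using cx c unfolding complexification_def by blast
  have ch: "is_chart c" using K c mfd_structure_is_chart unfolding kaehler_def by blast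
  have chC: "is_chart C" by (rule mfd_structure_is_chart[OF JC C])
  note \<iota> = complexified_chart_iota[OF cc]
  have opW: "open W" and \<epsilon>: "\<epsilon> > 0"
    and \<eta>0: "\<And>y. y \<in> W \<Longrightarrow> \<eta> 0 y = y"
    and curve: "\<And>y. y \<in> W \<Longrightarrow> integral_curve_on JC
        (\<lambda>c q. - ham_vf (re_form \<omega>C) (\<lambda>x. Re (P x)) c q) {-\<epsilon><..<\<epsilon>} (\<lambda>t. \<eta> t y)"
    using flow unfolding local_flow_def by auto
  let ?Y = "ham_coords \<omega>C P C"
  have opC: "open (chart_img C)" using chC by (simp add: is_chart_def)
  have Y: "holo_map_on (chart_img C) ?Y" by (rule holo_map_on_ham_coords[OF JC \<omega>C Pholo C])
  define a where "a = coord C (\<iota> p\<^sub>0)"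
  have p\<^sub>0: "p\<^sub>0 \<in> chart_dom c" using V\<^sub>0 by blast
  define T where "T = coord C ` (chart_dom C \<inter> W)"
  have "open T" unfolding T_def by (rule open_coord_image[OF chC opW])
  moreover have "a \<in> T" using \<iota>(1)[OF p\<^sub>0] W by (auto simp: T_def a_def)
  ultimately obtain e where e: "e > 0" "cball a e \<subseteq> T"
    using open_contains_cball by blast
  have TC: "T \<subseteq> chart_img C" by (auto simp: T_def)
  have TW: "q \<in> W" if "q \<in> chart_dom C" "coord C q \<in> T" for q
    using that coord_inject[OF chC] unfolding T_def by blast
  define R where "R = e / 3"
  have R: "R > 0" and e3: "2 * R + R = e" using e by (simp_all add: R_def)
  have sub: "cball a (2 * R + R) \<subseteq> chart_img C" using e TC e3 by auto
  have "bounded (?Y ` cball a (2 * R + R))"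
    using continuous_on_subset[OF holo_map_on_continuous_on[OF Y] sub]
    by (intro compact_imp_bounded compact_continuous_image) auto
  then obtain B where B: "B > 0" "\<And>y. y \<in> cball a (2 * R + R) \<Longrightarrow> norm (?Y y) \<le> B"
    unfolding bounded_pos by blast
  \<comment> \<open>For such times the curve moves by less than \<open>R\<close>, the Taylor series along it converges
    (this is where \<open>exp 1 \<le> 3\<close> enters), and \<open>\<phi>\<close> is given by the exponential series.\<close>
  define \<delta> where "\<delta> = min \<epsilon> (min (R / (3 * B)) (\<rho> / (cmod \<tau> + 1)))"
  have \<delta>: "\<delta> > 0" using \<epsilon> R B(1) \<rho> by (simp add: \<delta>_def add_nonneg_pos)
  have \<delta>\<epsilon>: "\<delta> \<le> \<epsilon>" and \<delta>B: "t < \<delta> \<Longrightarrow> 3 * B * t < R" for t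
    using B(1) by (auto simp: \<delta>_def field_simps)
  have \<delta>\<rho>: "cmod (of_real t * \<tau>) < \<rho>" if "\<bar>t\<bar> < \<delta>" for t
  proof -
    have "\<bar>t\<bar> * (cmod \<tau> + 1) < \<rho>"
      using that by (simp add: \<delta>_def pos_less_divide_eq add_nonneg_pos)
    then show ?thesis by (simp add: norm_mult distrib_left)
  qed
  define V where "V = V\<^sub>0 \<inter> {p \<in> chart_dom c. coord c p \<in> conj_graph -` ball a R}"
  have "open (conj_graph -` ball a R)"
    by (intro open_vimage open_ball continuous_intros linear_continuous_on bounded_linear_conj_graph)
  then have "open V" unfolding V_def by (intro open_Int V\<^sub>0 open_coord_preimage[OF ch])
  moreover have "p\<^sub>0 \<in> V" using V\<^sub>0 p\<^sub>0 \<iota>(2)[OF p\<^sub>0] R by (simp add: V_def a_def)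
  moreover have "\<eta> t (\<iota> p) \<in> W \<and> \<pi>\<^sub>0 (\<eta> (- t) (\<iota> p)) = \<phi> (of_real t * \<tau>) p"
    if p: "p \<in> V" and t: "\<bar>t\<bar> < \<delta>" for p t
  proof -
    have pc: "p \<in> chart_dom c" and pV: "p \<in> V\<^sub>0" and pa: "coord C (\<iota> p) \<in> cball a R"
      using p \<iota>(2)[of p] by (auto simp: V_def)
    have \<iota>W: "\<iota> p \<in> W" using W by auto
    have cont: "continuous_on {-\<epsilon><..<\<epsilon>} (\<lambda>s. \<eta> s (\<iota> p))"
      using curve[OF \<iota>W] by (simp add: integral_curve_on_def)
    have der: "((\<lambda>s. coord C (\<eta> s (\<iota> p))) has_vector_derivative - ?Y (coord C (\<eta> s (\<iota> p)))) (at s)"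
      if "\<bar>s\<bar> < \<epsilon>" "\<eta> s (\<iota> p) \<in> chart_dom C" for s
    proof -
      have "s \<in> {-\<epsilon><..<\<epsilon>}" using that by auto
      then have "((\<lambda>s. coord C (\<eta> s (\<iota> p))) has_vector_derivative
          - ham_vf (re_form \<omega>C) (\<lambda>x. Re (P x)) C (\<eta> s (\<iota> p))) (at s)"
        using curve[OF \<iota>W] that(2) C unfolding integral_curve_on_def by blast
      then show ?thesis by (simp add: ham_coords_def param_coord[OF chC that(2)])
    qed
    have der': "((\<lambda>s. coord C (\<eta> (- s) (\<iota> p))) has_vector_derivative ?Y (coord C (\<eta> (- s) (\<iota> p)))) (at s)"
      if "\<bar>s\<bar> < \<epsilon>" "\<eta> (- s) (\<iota> p) \<in> chart_dom C" for s
    proof -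
      have "(uminus has_vector_derivative (- 1 :: real)) (at s)"
        unfolding has_vector_derivative_def by (auto intro!: derivative_eq_intros)
      from vector_diff_chain_at[OF this der[of "- s"]] show ?thesis
        using that by (simp add: comp_def)
    qed
    have stay: "\<eta> s (\<iota> p) \<in> chart_dom C \<and> coord C (\<eta> s (\<iota> p)) \<in> ball a (2 * R)" if s: "\<bar>s\<bar> < \<delta>" for s
    proof -
      have "0 \<le> B * \<bar>s\<bar>" using B(1) by simp
      moreover have "3 * (B * \<bar>s\<bar>) < R" using \<delta>B[OF s] by (simp add: mult.assoc)
      ultimately have small: "R + B * \<bar>s\<bar> < 2 * R" by linarith
      have sub2: "cball a (2 * R) \<subseteq> chart_img C" using sub R by auto
      have bnd: "norm (?Y y) \<le> B" if "y \<in> cball a (2 * R)" for y using B(2)[of y] that R by auto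
      have start: "\<eta> 0 (\<iota> p) \<in> chart_dom C" "coord C (\<eta> 0 (\<iota> p)) \<in> cball a R"
        using \<iota>(1)[OF pc] pa by (simp_all add: \<eta>0[OF \<iota>W])
      show ?thesis
      proof (cases "0 \<le> s")
        case True
        have "\<eta> \<bar>s\<bar> (\<iota> p) \<in> chart_dom C \<and> coord C (\<eta> \<bar>s\<bar> (\<iota> p)) \<in> ball a (2 * R)"
        proof (rule curve_confined[OF chC sub2 _ _ _ _ _ _ small,
              where \<gamma> = "\<lambda>s. \<eta> s (\<iota> p)" and v = "\<lambda>u. - ?Y (coord C (\<eta> u (\<iota> p)))"])
          show "continuous_on {0..\<bar>s\<bar>} (\<lambda>s. \<eta> s (\<iota> p))"
            by (rule continuous_on_subset[OF cont]) (use s \<delta>\<epsilon> in auto)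
        qed (use der bnd B(1) s \<delta>\<epsilon> start in auto)
        then show ?thesis using True by simp
      next
        case False
        have "\<eta> (- \<bar>s\<bar>) (\<iota> p) \<in> chart_dom C \<and> coord C (\<eta> (- \<bar>s\<bar>) (\<iota> p)) \<in> ball a (2 * R)"
        proof (rule curve_confined[OF chC sub2 _ _ _ _ _ _ small,
              where \<gamma> = "\<lambda>s. \<eta> (- s) (\<iota> p)" and v = "\<lambda>u. ?Y (coord C (\<eta> (- u) (\<iota> p)))"])
          show "continuous_on {0..\<bar>s\<bar>} (\<lambda>s. \<eta> (- s) (\<iota> p))"
            by (rule continuous_on_compose2[OF cont]) (use s \<delta>\<epsilon> in \<open>auto intro!: continuous_intros\<close>)
        qed (use der' bnd B(1) s \<delta>\<epsilon> start in auto)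
        then show ?thesis using False by simp
      qed
    qed
    have "\<eta> t (\<iota> p) \<in> W"
    proof (rule TW)
      show "\<eta> t (\<iota> p) \<in> chart_dom C" using stay[OF t] by simp
      show "coord C (\<eta> t (\<iota> p)) \<in> T"
        using stay[OF t] e3 R by (intro subsetD[OF e(2)]) simp
    qed
    moreover have "\<pi>\<^sub>0 (\<eta> (- t) (\<iota> p)) = \<phi> (of_real t * \<tau>) p"
    proof (rule coord_inject[OF ch])
      have dom: "\<eta> (- t) (\<iota> p) \<in> chart_dom C" using stay[of "- t"] t by simp
      show "\<pi>\<^sub>0 (\<eta> (- t) (\<iota> p)) \<in> chart_dom c"
        using cc dom unfolding complexified_chart_def by blast
      show "\<phi> (of_real t * \<tau>) p \<in> chart_dom c" by (rule \<phi>dom[OF \<delta>\<rho>[OF t] pV])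
      have "coord C (\<eta> (- t) (\<iota> p)) $ Inl i = coord c (\<phi> (of_real t * \<tau>) p) $ i" for i
      proof (rule sums_unique2)
        let ?F = "\<lambda>x :: complex^('n + 'n). x $ Inl i"
        have "(\<lambda>k. of_real t ^ k / fact k * (deriv_along ?Y ^^ k) ?F (coord C (\<eta> (- 0) (\<iota> p))))
            sums ?F (coord C (\<eta> (- t) (\<iota> p)))"
        proof (rule taylor_along_integral_curve[where x = "\<lambda>s. coord C (\<eta> (- s) (\<iota> p))",
              OF opC holo_on_component Y sub R _ B(2) _ _ t])
          show "cmod (y $ Inl i) \<le> norm a + (2 * R + R)" if "y \<in> cball a (2 * R + R)" for y
          proof -
            have "norm y \<le> norm a + norm (y - a)" by (metis add.commute diff_add_cancel norm_triangle_ineq)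
            also have "norm (y - a) \<le> 2 * R + R" using that by (simp add: dist_norm norm_minus_commute)
            finally show ?thesis using order_trans[OF Finite_Cartesian_Product.norm_nth_le] by fastforce
          qed
          show "coord C (\<eta> (- s) (\<iota> p)) \<in> cball a (2 * R)"
            "((\<lambda>s. coord C (\<eta> (- s) (\<iota> p))) has_vector_derivative ?Y (coord C (\<eta> (- s) (\<iota> p)))) (at s)"
            if "\<bar>s\<bar> < \<delta>" for s
            using stay[of "- s"] der'[of s] that \<delta>\<epsilon> by auto
          have "exp 1 * (B * \<bar>t\<bar>) \<le> 3 * (B * \<bar>t\<bar>)"
            using exp_le B(1) by (intro mult_right_mono) auto
          then show "exp 1 * B * \<bar>t\<bar> < R" using \<delta>B[OF t] by (simp add: mult.assoc)
        qed
        moreover have "(deriv_along ?Y ^^ k) ?F (coord C (\<iota> p)) =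
            \<tau> ^ k * (lie (ham_vf \<omega> h) c ^^ k) (\<lambda>m. coord c m $ i) p" for k
        proof (rule deriv_along_iterate_on_real_locus[OF JC \<omega>C Pholo C K c cc P\<iota> holo_on_component _ pc])
          show "coord c m $ i = coord C (\<iota> m) $ Inl i" if "m \<in> chart_dom c" for m
            by (simp add: \<iota>(2)[OF that] conj_graph_def)
        qed
        ultimately show "(\<lambda>k. (of_real t * \<tau>) ^ k / fact k * (lie (ham_vf \<omega> h) c ^^ k) (\<lambda>m. coord c m $ i) p)
            sums (coord C (\<eta> (- t) (\<iota> p)) $ Inl i)"
          by (simp add: \<eta>0[OF \<iota>W] power_mult_distrib mult_ac)
        show "(\<lambda>k. (of_real t * \<tau>) ^ k / fact k * (lie (ham_vf \<omega> h) c ^^ k) (\<lambda>m. coord c m $ i) p)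
            sums (coord c (\<phi> (of_real t * \<tau>) p) $ i)"
          by (rule \<phi>exp[OF \<delta>\<rho>[OF t] pV])
      qed
      moreover have "coord c (\<pi>\<^sub>0 (\<eta> (- t) (\<iota> p))) = zC (coord C (\<eta> (- t) (\<iota> p)))"
        using cc dom unfolding complexified_chart_def by blast
      ultimately show "coord c (\<pi>\<^sub>0 (\<eta> (- t) (\<iota> p))) = coord c (\<phi> (of_real t * \<tau>) p)"
        by (simp add: zC_def vec_eq_iff)
    qed
    ultimately show ?thesis by blast
  qed
  ultimately show ?thesis using \<delta> by blast
qed

lemma compact_uniform_time:
  fixes Q :: "'m::topological_space \<Rightarrow> real \<Rightarrow> bool"
  assumes "compact (UNIV :: 'm set)"
    and local: "\<And>p. \<exists>V \<delta>. open V \<and> p \<in> V \<and> \<delta> > 0 \<and> (\<forall>q\<in>V. \<forall>t. \<bar>t\<bar> < \<delta> \<longrightarrow> Q q t)"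
  shows "\<exists>\<delta>>0. \<forall>q t. \<bar>t\<bar> < \<delta> \<longrightarrow> Q q t"
proof -
  obtain V \<delta> where V: "\<And>p. open (V p)" "\<And>p. p \<in> V p" and \<delta>: "\<And>p. \<delta> p > 0"
    and Q: "\<And>p q t. q \<in> V p \<Longrightarrow> \<bar>t\<bar> < \<delta> p \<Longrightarrow> Q q t"
    using local by metis
  obtain D where D: "finite D" "UNIV \<subseteq> (\<Union>p\<in>D. V p)"
    using compactE_image[OF assms(1), of UNIV V] V by (metis UNIV_I UN_I subsetI)
  define d where "d = Min (insert 1 (\<delta> ` D))"
  have "d > 0" using D \<delta> by (simp add: d_def)
  moreover have "Q q t" if "\<bar>t\<bar> < d" for q t
  proof -
    obtain p where p: "p \<in> D" "q \<in> V p" using D by blast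
    then have "d \<le> \<delta> p" using D by (auto simp: d_def intro!: Min_le)
    then show ?thesis using Q[OF p(2)] that by simp
  qed
  ultimately show ?thesis by blast
qed

text \<open>Both sides say that the integral curves \<open>s \<mapsto> \<eta> s y\<close> and \<open>s \<mapsto> \<eta> (s - t) z\<close> have a common point:
  the left one at \<open>s = t\<close>, the right one at \<open>s = 0\<close>.  This is the substitute for the group law when
  \<open>\<eta>\<close> is known to be a flow only from points of \<open>W\<close> on.\<close>

lemma local_flow_shift:
  fixes A :: "('m::t2_space, 'e::euclidean_space) chart set"
  assumes A: "mfd_structure K A" and X: "locally_lipschitz_vf A X"
    and flow: "local_flow A X W \<epsilon> \<eta>" and y: "y \<in> W" and z: "z \<in> W" and t: "\<bar>t\<bar> < \<epsilon>"
  shows "\<eta> t y = z \<longleftrightarrow> y = \<eta> (- t) z"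
proof -
  let ?I = "{-\<epsilon><..<\<epsilon>} \<inter> {t-\<epsilon><..<t+\<epsilon>}"
  have \<epsilon>: "\<epsilon> > 0" and start: "\<eta> 0 y = y" "\<eta> 0 z = z"
    and cy: "integral_curve_on A X {-\<epsilon><..<\<epsilon>} (\<lambda>s. \<eta> s y)"
    and cz: "integral_curve_on A X {-\<epsilon><..<\<epsilon>} (\<lambda>s. \<eta> s z)"
    using flow y z by (auto simp: local_flow_def)
  have I: "open ?I" "connected ?I" "0 \<in> ?I" "t \<in> ?I"
    using \<epsilon> t by (auto intro!: is_interval_connected is_interval_Int)
  have c1: "integral_curve_on A X ?I (\<lambda>s. \<eta> s y)"
    using cy unfolding integral_curve_on_def by (auto intro: continuous_on_subset)
  have c2: "integral_curve_on A X ?I (\<lambda>s. \<eta> (s - t) z)"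
    unfolding integral_curve_on_def
  proof (intro conjI ballI impI)
    show "continuous_on ?I (\<lambda>s. \<eta> (s - t) z)"
      by (rule continuous_on_compose2[of "{-\<epsilon><..<\<epsilon>}" "\<lambda>s. \<eta> s z"])
        (use cz in \<open>auto simp: integral_curve_on_def intro!: continuous_intros\<close>)
    fix s c assume s: "s \<in> ?I" "c \<in> A" "\<eta> (s - t) z \<in> chart_dom c"
    then have der: "((\<lambda>s. coord c (\<eta> s z)) has_vector_derivative X c (\<eta> (s - t) z)) (at (s - t))"
      using cz by (auto simp: integral_curve_on_def)
    have "((\<lambda>s. s - t) has_vector_derivative 1) (at s)"
      unfolding has_vector_derivative_def by (auto intro!: derivative_eq_intros)
    from vector_diff_chain_at[OF this der]
    show "((\<lambda>s. coord c (\<eta> (s - t) z)) has_vector_derivative X c (\<eta> (s - t) z)) (at s)"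
      by (simp add: comp_def)
  qed
  note unique = integral_curve_unique[OF A X I(1,2) c1 c2]
  show ?thesis
    using unique[OF I(4) _ I(3)] unique[OF I(3) _ I(4)] start by auto
qed

lemma local_flow_inj:
  fixes A :: "('m::t2_space, 'e::euclidean_space) chart set"
  assumes A: "mfd_structure K A" and X: "locally_lipschitz_vf A X"
    and flow: "local_flow A X W \<epsilon> \<eta>" and y: "y \<in> W" and z: "z \<in> W" and t: "\<bar>t\<bar> < \<epsilon>"
    and eq: "\<eta> t y = \<eta> t z"
  shows "y = z"
proof -
  have \<epsilon>: "\<epsilon> > 0" and start: "\<eta> 0 y = y" "\<eta> 0 z = z"
    and cy: "integral_curve_on A X {-\<epsilon><..<\<epsilon>} (\<lambda>s. \<eta> s y)"
    and cz: "integral_curve_on A X {-\<epsilon><..<\<epsilon>} (\<lambda>s. \<eta> s z)"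
    using flow y z by (auto simp: local_flow_def)
  have "\<eta> 0 y = \<eta> 0 z"
    by (rule integral_curve_unique[OF A X _ _ cy cz _ eq]) (use \<epsilon> t in auto)
  then show ?thesis by (simp only: start)
qed

theorem proposition8p1:
  fixes A J\<^sub>0 :: "('m::{t2_space,second_countable_topology}, complex^'n) chart set"
    and \<omega> :: "('m, complex^'n, real) form2"
    and h :: "'m \<Rightarrow> real"
    and \<tau> :: complex
    and J\<^sub>C :: "('c::{t2_space,second_countable_topology}, complex^('n + 'n)) chart set"
    and \<omega>\<^sub>C :: "('c, complex^('n + 'n), complex) form2"
    and \<iota> :: "'m \<Rightarrow> 'c"
    and \<pi>\<^sub>0 :: "'c \<Rightarrow> 'm"
    and th\<^sub>C :: "'c \<Rightarrow> complex"
    and W :: "'c set" and \<epsilon> :: real and \<eta> :: "real \<Rightarrow> 'c \<Rightarrow> 'c"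
    and \<rho> :: real
    and J :: "complex \<Rightarrow> ('m, complex^'n) chart set"
    and \<phi> :: "complex \<Rightarrow> 'm \<Rightarrow> 'm"
  assumes "compact (UNIV :: 'm set)"
    and "real_analytic_structure A"
    and "kaehler (smooth_charts A) J\<^sub>0 \<omega>"
    and "J\<^sub>0 \<subseteq> A"
    and "regular_form real_analytic_on A \<omega>"
    and "regular_fun real_analytic_on A h"
    and "complexification J\<^sub>0 \<omega> J\<^sub>C \<omega>\<^sub>C \<iota> \<pi>\<^sub>0"
    and "analytic_continuation J\<^sub>C \<iota> (\<lambda>p. \<tau> * complex_of_real (h p)) th\<^sub>C"
    and "range \<iota> \<subseteq> W"
    and "local_flow J\<^sub>C (\<lambda>c q. - ham_vf (re_form \<omega>\<^sub>C) (\<lambda>x. Re (th\<^sub>C x)) c q) W \<epsilon> \<eta>"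
    and "\<rho> > 0"
    and "\<And>\<sigma>. cmod \<sigma> < \<rho> \<Longrightarrow> kaehler (smooth_charts A) (J \<sigma>) \<omega>"
    and "\<And>\<sigma>. cmod \<sigma> < \<rho> \<Longrightarrow> biholomorphism (J \<sigma>) J\<^sub>0 (\<phi> \<sigma>)"
    and "acts_as_exp J\<^sub>0 (ham_vf \<omega> h) \<rho> \<phi>"
  shows "\<exists>\<delta>>0. \<forall>t::real. \<bar>t\<bar> < \<delta> \<longrightarrow>
    (let \<pi>\<^sub>t = leaf_projection \<iota> (push_foliation (\<eta> t) (fibre_foliation W \<pi>\<^sub>0))
     in inv (\<phi> (of_real t * \<tau>)) = \<pi>\<^sub>t \<circ> \<eta> t \<circ> \<iota> \<and>
        \<phi> (of_real t * \<tau>) \<circ> \<pi>\<^sub>t \<circ> \<eta> t \<circ> \<iota> = id)"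
proof -
  have JC: "complex_structure J\<^sub>C" and \<omega>C: "holomorphic_symplectic J\<^sub>C \<omega>\<^sub>C"
    and \<pi>\<iota>: "\<And>p. \<pi>\<^sub>0 (\<iota> p) = p"
    using assms(7) by (auto simp: complexification_def fun_eq_iff)
  have "regular_fun holo_on J\<^sub>C th\<^sub>C" using assms(8) by (simp add: analytic_continuation_def)
  note lip = locally_lipschitz_ham[OF JC \<omega>C this]
  note flow = assms(10)
  have \<iota>W: "\<iota> p \<in> W" for p using assms(9) by auto
  obtain d where d: "d > 0"
    and near: "\<And>p t. \<bar>t\<bar> < d \<Longrightarrow> \<eta> t (\<iota> p) \<in> W \<and> \<pi>\<^sub>0 (\<eta> (- t) (\<iota> p)) = \<phi> (of_real t * \<tau>) p"
    using compact_uniform_time[OF assms(1) flow_projects_to_exp_near[OF assms(3,7-11,14)]] by metis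
  define \<delta> where "\<delta> = min \<epsilon> (min d (\<rho> / (cmod \<tau> + 1)))"
  have "\<epsilon> > 0" using flow by (simp add: local_flow_def)
  then have "\<delta> > 0" using d assms(11) by (simp add: \<delta>_def add_nonneg_pos)
  moreover have "let \<pi>\<^sub>t = leaf_projection \<iota> (push_foliation (\<eta> t) (fibre_foliation W \<pi>\<^sub>0))
     in inv (\<phi> (of_real t * \<tau>)) = \<pi>\<^sub>t \<circ> \<eta> t \<circ> \<iota> \<and>
        \<phi> (of_real t * \<tau>) \<circ> \<pi>\<^sub>t \<circ> \<eta> t \<circ> \<iota> = id" if t: "\<bar>t\<bar> < \<delta>" for t :: real
  proof -
    have t\<epsilon>: "\<bar>t\<bar> < \<epsilon>" and td: "\<bar>t\<bar> < d" and "\<bar>t\<bar> * (cmod \<tau> + 1) < \<rho>"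
      using t by (simp_all add: \<delta>_def pos_less_divide_eq add_nonneg_pos)
    then have "cmod (of_real t * \<tau>) < \<rho>" by (simp add: norm_mult distrib_left)
    then have bij: "bij (\<phi> (of_real t * \<tau>))" using assms(13) by (simp add: biholomorphism_def)
    let ?\<phi> = "\<phi> (of_real t * \<tau>)"
    let ?F = "push_foliation (\<eta> t) (fibre_foliation W \<pi>\<^sub>0)"
    have leaf: "(\<exists>L\<in>?F. \<eta> t (\<iota> p) \<in> L \<and> \<iota> p' \<in> L) \<longleftrightarrow> p' = inv ?\<phi> p" for p p'
    proof
      assume "\<exists>L\<in>?F. \<eta> t (\<iota> p) \<in> L \<and> \<iota> p' \<in> L"
      then obtain y y' where y: "y \<in> W" "\<eta> t (\<iota> p) = \<eta> t y"
        and y': "y' \<in> W" "\<iota> p' = \<eta> t y'" and same: "\<pi>\<^sub>0 y = \<pi>\<^sub>0 y'"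
        unfolding push_foliation_def fibre_foliation_def by auto
      have "y = \<iota> p" using local_flow_inj[OF JC lip flow \<iota>W y(1) t\<epsilon> y(2)] by simp
      moreover have "y' = \<eta> (- t) (\<iota> p')"
        by (rule local_flow_shift[OF JC lip flow y'(1) \<iota>W t\<epsilon>, THEN iffD1]) (simp add: y'(2))
      ultimately have "?\<phi> p' = p" using near[OF td, of p'] same \<pi>\<iota> by simp
      then show "p' = inv ?\<phi> p" using bij by (metis bij_inv_eq_iff)
    next
      assume "p' = inv ?\<phi> p"
      then have "?\<phi> p' = p" using bij by (metis bij_inv_eq_iff)
      define y where "y = \<eta> (- t) (\<iota> p')"
      have y: "y \<in> W" "\<pi>\<^sub>0 y = p"
        using near[of "- t" p'] near[of t p'] td \<open>?\<phi> p' = p\<close> by (auto simp: y_def)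
      have "\<eta> t y = \<iota> p'"
        using local_flow_shift[OF JC lip flow y(1) \<iota>W t\<epsilon>] by (simp add: y_def)
      then have "\<iota> p' \<in> \<eta> t ` (W \<inter> \<pi>\<^sub>0 -` {p})" using y by (intro image_eqI[of _ _ y]) auto
      moreover have "\<eta> t (\<iota> p) \<in> \<eta> t ` (W \<inter> \<pi>\<^sub>0 -` {p})" using \<iota>W \<pi>\<iota> by auto
      moreover have "\<eta> t ` (W \<inter> \<pi>\<^sub>0 -` {p}) \<in> ?F"
        unfolding push_foliation_def fibre_foliation_def by (intro imageI rangeI)
      ultimately show "\<exists>L\<in>?F. \<eta> t (\<iota> p) \<in> L \<and> \<iota> p' \<in> L" by (intro bexI conjI)
    qed
    have "leaf_projection \<iota> ?F (\<eta> t (\<iota> p)) = inv ?\<phi> p" for p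
      unfolding leaf_projection_def leaf by simp
    then show ?thesis
      using bij by (simp add: Let_def fun_eq_iff bij_is_surj surj_f_inv_f)
  qed
  ultimately show ?thesis by blast
qed

end
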